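(* Let $F$ be a $4$-regular graph. Then the Eulerian $3$-matroid $Q(F)$ has a strict, totally transversally unimodular representation.
   Context: Graphs may have loops and multiple edges; they are given by vertices, half-edges, a partition of half-edges into pairs (edges), and an incidence map from half-edges to vertices. $c(F)$ is the number of connected components. $F$ is $4$-regular if every vertex is incident with exactly $4$ half-edges. A single transition is an unordered pair of distinct half-edges at a common vertex; a transition at $v$ is a partition of the four half-edges at $v$ into two single transitions; $\mathfrak T(F)$ is the set of all transitions, and a transversal of $\mathfrak T(F)$ contains exactly one transition at each vertex. A circuit (closed trail, possibly repeating vertices, using each half-edge at most once) passes through a vertex via single transitions; a circuit partition $P$ is a set of circuits such that every half-edge lies in exactly one single transition of exactly one circuit of $P$, and $\tau(P)$ is the set of transitions both of whose single transitions occur in circuits of $P$; every transversal of $\mathfrak T(F)$ equals $\tau(P)$ for a unique $P$. Multimatroids: for a partition $\Omega$ of a finite set $U$ (skew classes), a transversal meets every skew class in exactly one element; a subtransversal is a subset of a transversal. A multimatroid $(U,\Omega,r)$ has $r$ from subtransversals to $\mathbb N$ such that on each subtransversal $S$, $r$ is a matroid rank function, and for $x\ne y$ in a skew class disjoint from $S$, $\max\{r(S\cup\{x\}),r(S\cup\{y\})\}>r(S)$. A representation is a matrix with columns indexed by $U$ such that the rank of the columns in any subtransversal $S$ equals $r(S)$; it is strict if the matrix rank equals $\max r$. The Eulerian $3$-matroid $Q(F)$ is the unique multimatroid $(\mathfrak T(F),\Omega,r)$ whose skew classes are the sets of three transitions at each vertex and with $r(\tau(P))=|V(F)|-(|P|-c(F))$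 for every circuit partition $P$. A real $X\times\mathfrak T(F)$ matrix is totally transversally unimodular if for every transversal $T$ of $\mathfrak T(F)$, its submatrix of columns in $T$ is totally unimodular (every square submatrix has determinant in $\{-1,0,1\}$). *)

theory Defs
  imports "HOL-Library.Disjoint_Sets" "Jordan_Normal_Form.Determinant"
begin

section \<open>Graphs given by half-edges\<close>

record ('v, 'h) hgraph =
  verts :: "'v set"
  halfs :: "'h set"
  edges :: "'h set set"
  inc   :: "'h \<Rightarrow> 'v"

definition wf_hgraph :: "('v, 'h) hgraph \<Rightarrow> bool" where
  "wf_hgraph F \<longleftrightarrow> finite (verts F) \<and> finite (halfs F) \<and>
     partition_on (halfs F) (edges F) \<and> (\<forall>e\<in>edges F. card e = 2) \<and>
     inc F ` halfs F \<subseteq> verts F"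

definition halfs_at :: "('v, 'h) hgraph \<Rightarrow> 'v \<Rightarrow> 'h set" where
  "halfs_at F v = {h \<in> halfs F. inc F h = v}"

definition four_regular :: "('v, 'h) hgraph \<Rightarrow> bool" where
  "four_regular F \<longleftrightarrow> (\<forall>v\<in>verts F. card (halfs_at F v) = 4)"

text \<open>Number of connected components c(F): classes of the vertex set under reachability.\<close>
definition adj_rel :: "('v, 'h) hgraph \<Rightarrow> ('v \<times> 'v) set" where
  "adj_rel F = {(inc F a, inc F b) | a b. {a, b} \<in> edges F}"

definition num_components :: "('v, 'h) hgraph \<Rightarrow> nat" where
  "num_components F = card (verts F // Restr ((adj_rel F)\<^sup>*) (verts F))"

section \<open>Transitions\<close>

definition single_transition :: "('v, 'h) hgraph \<Rightarrow> 'h set \<Rightarrow> bool" where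
  "single_transition F s \<longleftrightarrow> (\<exists>a b. s = {a, b} \<and> a \<noteq> b \<and> a \<in> halfs F \<and> b \<in> halfs F
      \<and> inc F a = inc F b)"

definition transition_at :: "('v, 'h) hgraph \<Rightarrow> 'v \<Rightarrow> 'h set set \<Rightarrow> bool" where
  "transition_at F v t \<longleftrightarrow> v \<in> verts F \<and>
     (\<exists>s1 s2. t = {s1, s2} \<and> single_transition F s1 \<and> single_transition F s2 \<and>
        s1 \<inter> s2 = {} \<and> s1 \<union> s2 = halfs_at F v)"

definition transitions :: "('v, 'h) hgraph \<Rightarrow> 'h set set set" where
  "transitions F = {t. \<exists>v. transition_at F v t}"

text \<open>Skew classes of Q(F): the sets of transitions at each vertex.\<close>
definition skew_classes :: "('v, 'h) hgraph \<Rightarrow> 'h set set set set" where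
  "skew_classes F = {{t. transition_at F v t} | v. v \<in> verts F}"

text \<open>The circuit partition P with tau(P) = T: its circuits correspond to the classes of
  half-edges linked by edges and by the single transitions occurring in T.
  num_circuits F T = |P|.\<close>
definition circuit_rel :: "('v, 'h) hgraph \<Rightarrow> 'h set set set \<Rightarrow> ('h \<times> 'h) set" where
  "circuit_rel F T = {(a, b) | a b. {a, b} \<in> edges F} \<union>
                     {(a, b) | a b. \<exists>t\<in>T. {a, b} \<in> t}"

definition num_circuits :: "('v, 'h) hgraph \<Rightarrow> 'h set set set \<Rightarrow> nat" where
  "num_circuits F T = card (halfs F // Restr ((circuit_rel F T)\<^sup>*) (halfs F))"

section \<open>Multimatroids\<close>

definition transversal :: "'a set set \<Rightarrow> 'a set \<Rightarrow> bool" where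
  "transversal \<Omega> T \<longleftrightarrow> T \<subseteq> \<Union>\<Omega> \<and> (\<forall>\<omega>\<in>\<Omega>. card (T \<inter> \<omega>) = 1)"

definition subtransversal :: "'a set set \<Rightarrow> 'a set \<Rightarrow> bool" where
  "subtransversal \<Omega> S \<longleftrightarrow> (\<exists>T. transversal \<Omega> T \<and> S \<subseteq> T)"

text \<open>Matroid rank function on ground set S (axioms R1--R3).\<close>
definition matroid_rank_on :: "'a set \<Rightarrow> ('a set \<Rightarrow> nat) \<Rightarrow> bool" where
  "matroid_rank_on S r \<longleftrightarrow>
     (\<forall>A. A \<subseteq> S \<longrightarrow> r A \<le> card A) \<and>
     (\<forall>A B. A \<subseteq> B \<and> B \<subseteq> S \<longrightarrow> r A \<le> r B) \<and>
     (\<forall>A B. A \<subseteq> S \<and> B \<subseteq> S \<longrightarrow> r (A \<union> B) + r (A \<inter> B) \<le> r A + r B)"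

definition multimatroid :: "'a set \<Rightarrow> 'a set set \<Rightarrow> ('a set \<Rightarrow> nat) \<Rightarrow> bool" where
  "multimatroid U \<Omega> r \<longleftrightarrow> finite U \<and> partition_on U \<Omega> \<and>
     (\<forall>S. subtransversal \<Omega> S \<longrightarrow> matroid_rank_on S r) \<and>
     (\<forall>S \<omega> x y. subtransversal \<Omega> S \<and> \<omega> \<in> \<Omega> \<and> \<omega> \<inter> S = {} \<and> x \<in> \<omega> \<and> y \<in> \<omega> \<and> x \<noteq> y
        \<longrightarrow> max (r (insert x S)) (r (insert y S)) > r S)"

text \<open>The Eulerian 3-matroid Q(F): the unique multimatroid on the transitions with the
  given skew classes and r(tau(P)) = |V| - (|P| - c(F)). The rank function is normalised to 0
  outside subtransversals (where it is not part of the multimatroid) so that it is unique.\<close>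
definition euler_rank :: "('v, 'h) hgraph \<Rightarrow> 'h set set set \<Rightarrow> nat" where
  "euler_rank F = (THE r. multimatroid (transitions F) (skew_classes F) r \<and>
     (\<forall>T. transversal (skew_classes F) T \<longrightarrow>
        int (r T) = int (card (verts F)) - (int (num_circuits F T) - int (num_components F))) \<and>
     (\<forall>S. \<not> subtransversal (skew_classes F) S \<longrightarrow> r S = 0))"

section \<open>Real matrices with rows {..<m} and columns indexed by 'u\<close>

definition lin_indep_cols :: "nat \<Rightarrow> (nat \<Rightarrow> 'u \<Rightarrow> real) \<Rightarrow> 'u set \<Rightarrow> bool" where
  "lin_indep_cols m M A \<longleftrightarrow>
     (\<forall>c. (\<forall>i<m. (\<Sum>x\<in>A. c x * M i x) = 0) \<longrightarrow> (\<forall>x\<in>A. c x = 0))"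

text \<open>Rank of the set of columns indexed by S.\<close>
definition col_rank :: "nat \<Rightarrow> (nat \<Rightarrow> 'u \<Rightarrow> real) \<Rightarrow> 'u set \<Rightarrow> nat" where
  "col_rank m M S = Max {card A | A. A \<subseteq> S \<and> lin_indep_cols m M A}"

definition totally_unimodular_cols :: "nat \<Rightarrow> (nat \<Rightarrow> 'u \<Rightarrow> real) \<Rightarrow> 'u set \<Rightarrow> bool" where
  "totally_unimodular_cols m M C \<longleftrightarrow>
     (\<forall>k f g. inj_on f {..<k} \<and> f ` {..<k} \<subseteq> {..<m} \<and> inj_on g {..<k} \<and> g ` {..<k} \<subseteq> C
        \<longrightarrow> det (mat k k (\<lambda>(i, j). M (f i) (g j))) \<in> {-1, 0, 1})"

definition representation ::
  "'u set set \<Rightarrow> ('u set \<Rightarrow> nat) \<Rightarrow> nat \<Rightarrow> (nat \<Rightarrow> 'u \<Rightarrow> real) \<Rightarrow> bool" where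
  "representation \<Omega> r m M \<longleftrightarrow> (\<forall>S. subtransversal \<Omega> S \<longrightarrow> col_rank m M S = r S)"

definition strict_representation ::
  "'u set \<Rightarrow> 'u set set \<Rightarrow> ('u set \<Rightarrow> nat) \<Rightarrow> nat \<Rightarrow> (nat \<Rightarrow> 'u \<Rightarrow> real) \<Rightarrow> bool" where
  "strict_representation U \<Omega> r m M \<longleftrightarrow> representation \<Omega> r m M \<and>
     col_rank m M U = Max (r ` {S. subtransversal \<Omega> S})"

definition totally_transversally_unimodular ::
  "'u set set \<Rightarrow> nat \<Rightarrow> (nat \<Rightarrow> 'u \<Rightarrow> real) \<Rightarrow> bool" where
  "totally_transversally_unimodular \<Omega> m M \<longleftrightarrow>
     (\<forall>T. transversal \<Omega> T \<longrightarrow> totally_unimodular_cols m M T)"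

end

theory Submission
  imports Defs
begin

text \<open>
  Regard a flow on \<open>F\<close> as an antisymmetric function on half-edges whose sum at every vertex vanishes.
  A transition \<open>t = {s, s'}\<close> gives the functional sending a flow to the net flow through \<open>s\<close>, and a flow
  is killed by all functionals of a transversal \<open>T\<close> iff it runs along the circuits determined by \<open>T\<close>.
  Flows vanishing on one chosen half-edge per component form a space of dimension \<open>|V|\<close>, in which the
  common kernel of \<open>T\<close> has dimension \<open>|P| - c(F)\<close>; so the matrix of the transition functionals in
  any basis is a strict representation of \<open>Q(F)\<close>.

  For total unimodularity take a basis dual to a set of half-edges. Splitting each vertex along its transition
  in \<open>T\<close> turns flows on \<open>F\<close> into flows on a cubic graph and the columns of \<open>T\<close> into coordinates of
  these flows. A flow on a graph that is the only one with its given integral coordinates is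
  integral, because the edges with non-integral values carry a nonzero flow of their own. Hence every
  nonsingular square submatrix is integral with integral inverse.
\<close>

section \<open>Families of linear functionals\<close>

text \<open>Without the normalisation at the roots, the flows have dimension |V| + c(F): there are
  2|V| edges, and the vertex equations are dependent once per component. A circuit never leaves its
  component, so roots of different components lie on different circuits. Fixing them removes one
  dimension per component both from the flows and from the kernel of a transversal, which has
  dimension |P| before; this is where c(F) in the rank formula comes from.

  \<open>Q(F)\<close> is given by a description operator, so its rank function has to be identified
  by uniqueness: the multimatroid axiom determines the rank of every subtransversal from the
  transversals containing it. The obstacle is therefore this axiom for the rank of functionals. It
  rests on a local fact: with the other vertices fixed, one of the three transitions at a vertex
  puts its two passages on different circuits, and at most one of these contains a root. The other
  carries a flow that detects both remaining transitions.

  The same axiom yields a transversal of full rank, so for the dimension of the flow space only an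
  upper bound has to be counted.\<close>

lemma homogeneous_system:
  fixes a :: "'e \<Rightarrow> 'x \<Rightarrow> real"
  assumes "finite E" "finite X" "card E < card X"
  shows "\<exists>c. (\<exists>x\<in>X. c x \<noteq> 0) \<and> (\<forall>e\<in>E. (\<Sum>x\<in>X. c x * a e x) = 0)"
  using assms
proof (induction E arbitrary: X a rule: finite_induct)
  case empty
  then obtain x where "x \<in> X" by fastforce
  then show ?case by (intro exI[of _ "\<lambda>_. 1"]) auto
next
  case (insert e E)
  show ?case
  proof (cases "\<forall>x\<in>X. a e x = 0")
    case True
    have "card E < card X" using insert by simp
    from insert.IH[OF insert.prems(1) this, of a] obtain c where
      "\<exists>x\<in>X. c x \<noteq> 0" "\<forall>e\<in>E. (\<Sum>x\<in>X. c x * a e x) = 0" by blast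
    then show ?thesis using True by (intro exI[of _ c]) auto
  next
    case False
    then obtain x0 where x0: "x0 \<in> X" "a e x0 \<noteq> 0" by blast
    define Y where "Y = X - {x0}"
    have X: "X = insert x0 Y" "x0 \<notin> Y" "finite Y" using x0 insert.prems by (auto simp: Y_def)
    have "card E < card Y" using insert X by simp
    \<comment> \<open>Gaussian elimination: solving equation \<open>e\<close> for the unknown
      \<open>x0\<close> turns every other equation into one over \<open>Y\<close>.\<close>
    from insert.IH[OF X(3) this, of "\<lambda>e' x. a e' x - a e' x0 * a e x / a e x0"] obtain c where
      c: "\<exists>x\<in>Y. c x \<noteq> 0"
      "\<forall>e'\<in>E. (\<Sum>x\<in>Y. c x * (a e' x - a e' x0 * a e x / a e x0)) = 0" by blast
    define c0 where "c0 = - (\<Sum>x\<in>Y. c x * a e x) / a e x0"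
    define d where "d = c(x0 := c0)"
    have sumd: "(\<Sum>x\<in>X. d x * a e' x) = c0 * a e' x0 + (\<Sum>x\<in>Y. c x * a e' x)" for e'
    proof -
      have "(\<Sum>x\<in>Y. d x * a e' x) = (\<Sum>x\<in>Y. c x * a e' x)"
        using X(2) by (intro sum.cong) (auto simp: d_def)
      then show ?thesis using X by (simp add: d_def)
    qed
    have "(\<Sum>x\<in>X. d x * a e' x) = 0" if "e' \<in> E" for e'
    proof -
      have "0 = (\<Sum>x\<in>Y. c x * a e' x - c x * a e x * (a e' x0 / a e x0))"
        using c(2) that by (simp add: algebra_simps)
      also have "\<dots> = (\<Sum>x\<in>Y. c x * a e' x) - (\<Sum>x\<in>Y. c x * a e x) * (a e' x0 / a e x0)"
        by (simp add: sum_subtractf sum_distrib_right sum_divide_distrib)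
      finally show ?thesis unfolding sumd by (simp add: c0_def)
    qed
    moreover have "(\<Sum>x\<in>X. d x * a e x) = 0" unfolding sumd using x0 by (simp add: c0_def)
    moreover have "\<exists>x\<in>X. d x \<noteq> 0" using c(1) X by (auto simp: d_def)
    ultimately show ?thesis by (intro exI[of _ d]) auto
  qed
qed

lemma sum_of_bool_mult:
  fixes f :: "'i \<Rightarrow> real"
  assumes "finite A" "a \<in> A"
  shows "(\<Sum>x\<in>A. f x * of_bool (x = a)) = f a" "(\<Sum>x\<in>A. f x * of_bool (a = x)) = f a"
  using assms by (simp_all add: of_bool_def if_distrib cong: if_cong)

definition functional :: "(('h \<Rightarrow> real) \<Rightarrow> real) \<Rightarrow> bool" where
  "functional l \<longleftrightarrow> (\<forall>z w c. l (\<lambda>h. z h + c * w h) = l z + c * l w)"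

lemma functional_add: "functional l \<Longrightarrow> l (\<lambda>h. z h + c * w h) = l z + c * l w"
  by (simp add: functional_def)

lemma functional_zero: "functional l \<Longrightarrow> l (\<lambda>_. 0) = 0"
  using functional_add[of l "\<lambda>_. 0" 1 "\<lambda>_. 0"] by simp

lemma functional_scale: "functional l \<Longrightarrow> l (\<lambda>h. c * w h) = c * l w"
  using functional_add[of l "\<lambda>_. 0" c w] by (simp add: functional_zero)

lemma functional_lincomb:
  assumes "functional l"
  shows "l (\<lambda>h. \<Sum>a\<in>A. c a * y a h) = (\<Sum>a\<in>A. c a * l (y a))"
proof (induction A rule: infinite_finite_induct)
  case (insert a A)
  have "l (\<lambda>h. \<Sum>a\<in>insert a A. c a * y a h) = l (\<lambda>h. (\<Sum>a\<in>A. c a * y a h) + c a * y a h)"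
    using insert by (simp add: add.commute)
  also have "\<dots> = l (\<lambda>h. (\<Sum>a\<in>A. c a * y a h)) + c a * l (y a)"
    using functional_add[OF assms] .
  finally show ?case using insert by simp
qed (use functional_zero[OF assms] in auto)

lemma matroid_rank_onD:
  assumes "matroid_rank_on S r"
  shows "A \<subseteq> S \<Longrightarrow> r A \<le> card A" "A \<subseteq> B \<Longrightarrow> B \<subseteq> S \<Longrightarrow> r A \<le> r B"
    "A \<subseteq> S \<Longrightarrow> B \<subseteq> S \<Longrightarrow> r (A \<union> B) + r (A \<inter> B) \<le> r A + r B"
  using assms unfolding matroid_rank_on_def by simp_all

text \<open>\<open>R\<close> is a linear subspace. The functionals are indexed rather than collected
  in a set because different indices may carry the same functional, like parallel columns of a
  matrix. All notions below concern restrictions to \<open>R\<close>.\<close>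

locale functional_family =
  fixes R :: "('h \<Rightarrow> real) set" and L :: "'i \<Rightarrow> ('h \<Rightarrow> real) \<Rightarrow> real"
  assumes zero_mem: "(\<lambda>_. 0) \<in> R"
    and add_mem: "\<And>z w c. z \<in> R \<Longrightarrow> w \<in> R \<Longrightarrow> (\<lambda>h. z h + c * w h) \<in> R"
    and functional: "\<And>i. functional (L i)"
begin

definition dual_fam :: "'i set \<Rightarrow> ('i \<Rightarrow> 'h \<Rightarrow> real) \<Rightarrow> bool" where
  "dual_fam A y \<longleftrightarrow> (\<forall>a\<in>A. y a \<in> R \<and> (\<forall>b\<in>A. L b (y a) = of_bool (a = b)))"

text \<open>Linear independence on \<open>R\<close>, expressed through dual vectors because the
  extension arguments and the final basis use these directly. For finite sets it agrees with the
  absence of linear relations, see \<open>indep_iff\<close>.\<close>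

definition indep :: "'i set \<Rightarrow> bool" where
  "indep A \<longleftrightarrow> (\<exists>y. dual_fam A y)"

text \<open>The dual form of span: for finite \<open>B\<close>, a functional is on \<open>R\<close>
  a linear combination of those of \<open>B\<close> iff it vanishes on their common kernel in
  \<open>R\<close>.\<close>

definition spans :: "'i set \<Rightarrow> 'i set \<Rightarrow> bool" where
  "spans B S \<longleftrightarrow> (\<forall>z\<in>R. (\<forall>a\<in>B. L a z = 0) \<longrightarrow> (\<forall>s\<in>S. L s z = 0))"

definition rk :: "'i set \<Rightarrow> nat" where
  "rk S = Max {card A | A. A \<subseteq> S \<and> indep A}"

lemma scale_mem: "z \<in> R \<Longrightarrow> (\<lambda>h. c * z h) \<in> R"
  using add_mem[OF zero_mem, of z c] by simp

lemma lincomb_mem: "(\<And>a. a \<in> A \<Longrightarrow> y a \<in> R) \<Longrightarrow> (\<lambda>h. \<Sum>a\<in>A. c a * y a h) \<in> R"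
proof (induction A rule: infinite_finite_induct)
  case (insert a A)
  then have "(\<lambda>h. (\<Sum>a\<in>A. c a * y a h) + c a * y a h) \<in> R"
    by (intro add_mem) auto
  then show ?case using insert by (simp add: add.commute)
qed (auto simp: zero_mem)

lemma residual_mem:
  assumes "z \<in> R" "\<And>a. a \<in> A \<Longrightarrow> y a \<in> R"
  shows "(\<lambda>h. z h - (\<Sum>a\<in>A. c a * y a h)) \<in> R"
  using add_mem[OF assms(1) lincomb_mem[of A y c, OF assms(2)], of "-1"] by simp

lemma functional_residual:
  assumes "functional l"
  shows "l (\<lambda>h. z h - (\<Sum>a\<in>A. c a * y a h)) = l z - (\<Sum>a\<in>A. c a * l (y a))"
  using functional_add[OF assms, of z "-1" "\<lambda>h. \<Sum>a\<in>A. c a * y a h"]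
  by (simp add: functional_lincomb[OF assms])

lemma indep_empty: "indep {}"
  by (simp add: indep_def dual_fam_def)

lemma indep_subset: "indep A \<Longrightarrow> B \<subseteq> A \<Longrightarrow> indep B"
  unfolding indep_def dual_fam_def by blast

lemma indep_insert:
  assumes "indep A" "finite A" "z \<in> R" "\<And>a. a \<in> A \<Longrightarrow> L a z = 0" "L b z \<noteq> 0"
  shows "indep (insert b A)"
proof -
  from assms(1) obtain y where y: "dual_fam A y" by (auto simp: indep_def)
  have b: "b \<notin> A" using assms(4,5) by blast
  define w where "w = (\<lambda>h. (1 / L b z) * z h)"
  have w: "w \<in> R" "\<And>a. a \<in> A \<Longrightarrow> L a w = 0" "L b w = 1"
    unfolding w_def functional_scale[OF functional] using assms
    by (simp_all only: scale_mem) simp_all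
  \<comment> \<open>Subtracting multiples of \<open>w\<close> makes the old dual vectors vanish at
    \<open>b\<close>; their values on \<open>A\<close> do not change because \<open>w\<close> is
    killed by \<open>A\<close>.\<close>
  define y' where "y' = (\<lambda>a. if a = b then w else (\<lambda>h. y a h + (- L b (y a)) * w h))"
  have "dual_fam (insert b A) y'"
    unfolding dual_fam_def
  proof (intro ballI conjI)
    fix a assume a: "a \<in> insert b A"
    show "y' a \<in> R" using a y w by (auto simp: y'_def dual_fam_def simp del: mult_minus_left intro!: add_mem)
    fix a' assume a': "a' \<in> insert b A"
    show "L a' (y' a) = of_bool (a = a')"
    proof (cases "a = b")
      case True
      then show ?thesis using a' w b by (auto simp: y'_def)
    next
      case False
      then have "L a' (y' a) = L a' (y a) + (- L b (y a)) * L a' w"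
        unfolding y'_def by (simp only: functional_add[OF functional] if_False)
      then show ?thesis using a a' False w y b by (auto simp: dual_fam_def)
    qed
  qed
  then show ?thesis by (auto simp: indep_def)
qed

text \<open>Steinitz bound. If \<open>Y\<close> were larger, some nontrivial combination of the
  vectors dual to \<open>Y\<close> would be killed by \<open>X\<close> and hence by
  \<open>Y\<close>, yet \<open>Y\<close> reads off its coefficients.\<close>

lemma card_indep_le:
  assumes "indep Y" "finite Y" "finite X"
    and sep: "spans X Y"
  shows "card Y \<le> card X"
proof (rule ccontr)
  assume "\<not> ?thesis"
  then have lt: "card X < card Y" by simp
  from assms(1) obtain w where w: "dual_fam Y w" by (auto simp: indep_def)
  from homogeneous_system[OF assms(3,2) lt, of "\<lambda>x y. L x (w y)"] obtain c y0 where
    c: "y0 \<in> Y" "c y0 \<noteq> 0" "\<forall>x\<in>X. (\<Sum>y\<in>Y. c y * L x (w y)) = 0" by blast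
  define z where "z = (\<lambda>h. \<Sum>y\<in>Y. c y * w y h)"
  have L: "L i z = (\<Sum>y\<in>Y. c y * L i (w y))" for i
    unfolding z_def by (rule functional_lincomb[OF functional])
  have "z \<in> R" unfolding z_def using w by (intro lincomb_mem) (auto simp: dual_fam_def)
  moreover have "L x z = 0" if "x \<in> X" for x using c(3) that by (simp add: L)
  ultimately have "L y0 z = 0" using sep c(1) by (auto simp: spans_def)
  moreover have "L y0 z = (\<Sum>y\<in>Y. c y * of_bool (y = y0))"
    unfolding L using w c by (intro sum.cong) (auto simp: dual_fam_def)
  ultimately show False using c assms(2) by (simp add: sum_of_bool_mult)
qed

text \<open>A largest independent set between \<open>A\<close> and \<open>S\<close> must span: a
  vector killed by it but not by some \<open>s\<close> would let \<open>s\<close> be added by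
  \<open>indep_insert\<close>.\<close>

lemma indep_extend:
  assumes "finite S" "A \<subseteq> S" "indep A"
  obtains B where "A \<subseteq> B" "B \<subseteq> S" "indep B"
    "spans B S"
proof -
  let ?P = "\<lambda>B. A \<subseteq> B \<and> B \<subseteq> S \<and> indep B"
  have "\<exists>B. ?P B \<and> (\<forall>B'. ?P B' \<longrightarrow> card B' \<le> card B)"
    by (rule ex_has_greatest_nat[of ?P A card "Suc (card S)"])
      (use assms card_mono in \<open>auto simp: less_Suc_eq_le\<close>)
  then obtain B where B: "?P B" "\<And>B'. ?P B' \<Longrightarrow> card B' \<le> card B" by auto
  have fB: "finite B" using B(1) assms(1) by (auto intro: finite_subset)
  have "L s z = 0" if "z \<in> R" "\<And>a. a \<in> B \<Longrightarrow> L a z = 0" "s \<in> S" for z s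
  proof (rule ccontr)
    assume n: "L s z \<noteq> 0"
    then have "s \<notin> B" using that by blast
    moreover have "indep (insert s B)" using indep_insert[of B z s] B(1) fB that n by auto
    ultimately show False using B(2)[of "insert s B"] B(1) that fB by auto
  qed
  then have "spans B S" by (auto simp: spans_def)
  then show ?thesis using that B(1) by auto
qed

lemma rk_eqI:
  assumes "finite S" "B \<subseteq> S" "indep B"
    "spans B S"
  shows "rk S = card B"
  unfolding rk_def
proof (rule Max_eqI)
  show "finite {card A |A. A \<subseteq> S \<and> indep A}"
    by (rule finite_subset[of _ "card ` Pow S"]) (use assms in auto)
  show "card B \<in> {card A |A. A \<subseteq> S \<and> indep A}" using assms by blast
  fix n assume "n \<in> {card A |A. A \<subseteq> S \<and> indep A}"
  then obtain A where A: "n = card A" "A \<subseteq> S" "indep A" by blast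
  have "spans B A" using assms(4) A(2) by (auto simp: spans_def)
  then show "n \<le> card B"
    using card_indep_le[OF A(3) finite_subset[OF A(2) assms(1)] finite_subset[OF assms(2,1)]] A(1) by simp
qed

lemma rk_ge: "finite S \<Longrightarrow> A \<subseteq> S \<Longrightarrow> indep A \<Longrightarrow> card A \<le> rk S"
  unfolding rk_def
  by (rule Max_ge) (auto intro: finite_subset[of _ "card ` Pow S"])

lemma rk_insert:
  assumes "finite S" "z \<in> R" "\<And>a. a \<in> S \<Longrightarrow> L a z = 0" "L b z \<noteq> 0"
  shows "rk (insert b S) > rk S"
proof -
  obtain B where B: "B \<subseteq> S" "indep B"
    "spans B S"
    by (rule indep_extend[OF assms(1) empty_subsetI indep_empty])
  have fB: "finite B" using B assms finite_subset by blast
  have "indep (insert b B)" using indep_insert[of B z b] B(1,2) fB assms by blast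
  then have "card (insert b B) \<le> rk (insert b S)" using B assms by (intro rk_ge) auto
  moreover have "b \<notin> B" using assms B(1) by blast
  ultimately show ?thesis using rk_eqI[OF assms(1) B] fB by simp
qed

lemma rk_le_card:
  assumes "finite S"
  shows "rk S \<le> card S"
proof -
  obtain B where B: "B \<subseteq> S" "indep B" "spans B S"
    by (rule indep_extend[OF assms empty_subsetI indep_empty])
  then show ?thesis using rk_eqI[OF assms B] card_mono[OF assms] by simp
qed

lemma matroid_rank_rk:
  assumes "finite S"
  shows "matroid_rank_on S rk"
  unfolding matroid_rank_on_def
proof (intro conjI allI impI)
  have fin: "finite A" if "A \<subseteq> S" for A by (rule finite_subset[OF that assms])
  fix A B
  { assume "A \<subseteq> S" then show "rk A \<le> card A" by (rule rk_le_card[OF fin]) }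
  { assume AB: "A \<subseteq> B \<and> B \<subseteq> S"
    then have f: "finite A" "finite B" using fin by auto
    obtain A' where "A' \<subseteq> A" "indep A'"
      "spans A' A"
      by (rule indep_extend[OF f(1) empty_subsetI indep_empty])
    then show "rk A \<le> rk B" using rk_eqI[OF f(1), of A'] rk_ge[OF f(2), of A'] AB by auto }
  { assume AB: "A \<subseteq> S \<and> B \<subseteq> S"
    then have f: "finite A" "finite B" "finite (A \<inter> B)" "finite (A \<union> B)" using fin by auto
    \<comment> \<open>Submodularity from nested bases \<open>C\<close>, \<open>D\<close>,
      \<open>E\<close> of \<open>A \<inter> B\<close>, \<open>A\<close> and
      \<open>A \<union> B\<close>: count \<open>E\<close> through its traces on \<open>A\<close> and
      \<open>B\<close>, whose overlap contains \<open>C\<close>.\<close>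
    obtain C where C: "C \<subseteq> A \<inter> B" "indep C"
      "spans C (A \<inter> B)"
      by (rule indep_extend[OF f(3) empty_subsetI indep_empty])
    have "C \<subseteq> A" using C(1) by blast
    then obtain D where D: "C \<subseteq> D" "D \<subseteq> A" "indep D"
      "spans D A"
      by (rule indep_extend[OF f(1) _ C(2)])
    have "D \<subseteq> A \<union> B" using D by blast
    then obtain E where E: "D \<subseteq> E" "E \<subseteq> A \<union> B" "indep E"
      "spans E (A \<union> B)"
      by (rule indep_extend[OF f(4) _ D(3)])
    have fE: "finite E" using E f finite_subset by blast
    have 1: "rk (A \<inter> B) = card C" "rk A = card D" "rk (A \<union> B) = card E"
      using rk_eqI[OF f(3) C] rk_eqI[OF f(1) D(2-4)] rk_eqI[OF f(4) E(2-4)] by auto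
    have i: "indep (E \<inter> A)" "indep (E \<inter> B)" using E(3) indep_subset by blast+
    have "card (E \<inter> A) \<le> card D" using rk_ge[OF f(1) _ i(1)] 1 by simp
    moreover have "card (E \<inter> B) \<le> rk B" using rk_ge[OF f(2) _ i(2)] by simp
    moreover have "card C \<le> card (E \<inter> A \<inter> B)"
      using C D E fE by (intro card_mono) auto
    moreover have "card E + card (E \<inter> A \<inter> B) = card (E \<inter> A) + card (E \<inter> B)"
    proof -
      have "E \<inter> A \<union> E \<inter> B = E" "E \<inter> A \<inter> (E \<inter> B) = E \<inter> A \<inter> B" using E by auto
      then show ?thesis using card_Un_Int[of "E \<inter> A" "E \<inter> B"] fE by simp
    qed
    ultimately show "rk (A \<union> B) + rk (A \<inter> B) \<le> rk A + rk B" using 1 by simp }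
qed

lemma indep_iff:
  assumes "finite A"
  shows "indep A \<longleftrightarrow> (\<forall>c. (\<forall>z\<in>R. (\<Sum>a\<in>A. c a * L a z) = 0) \<longrightarrow> (\<forall>a\<in>A. c a = 0))"
proof
  assume "indep A"
  then obtain y where y: "dual_fam A y" by (auto simp: indep_def)
  show "\<forall>c. (\<forall>z\<in>R. (\<Sum>a\<in>A. c a * L a z) = 0) \<longrightarrow> (\<forall>a\<in>A. c a = 0)"
  proof (intro allI impI ballI)
    fix c a assume "\<forall>z\<in>R. (\<Sum>a\<in>A. c a * L a z) = 0" and a: "a \<in> A"
    then have "0 = (\<Sum>x\<in>A. c x * L x (y a))" using y unfolding dual_fam_def by metis
    also have "\<dots> = (\<Sum>x\<in>A. c x * of_bool (a = x))"
      using y a by (intro sum.cong) (auto simp: dual_fam_def)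
    finally show "c a = 0" using a assms by (simp add: sum_of_bool_mult)
  qed
next
  assume ind: "\<forall>c. (\<forall>z\<in>R. (\<Sum>a\<in>A. c a * L a z) = 0) \<longrightarrow> (\<forall>a\<in>A. c a = 0)"
  obtain B where B: "B \<subseteq> A" "indep B"
    "spans B A"
    by (rule indep_extend[OF assms empty_subsetI indep_empty])
  have fB: "finite B" using B assms finite_subset by blast
  from B(2) obtain y where y: "dual_fam B y" by (auto simp: indep_def)
  have "b \<in> B" if b: "b \<in> A" for b
  proof (rule ccontr)
    assume nb: "b \<notin> B"
    \<comment> \<open>Since \<open>B\<close> spans \<open>A\<close>, on \<open>R\<close> the
      functional \<open>L b\<close> is the combination of the \<open>L a\<close> with coefficients
      \<open>L b (y a)\<close>; \<open>c\<close> is that relation.\<close>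
    define c where "c = (\<lambda>a. if a = b then 1 else if a \<in> B then - L b (y a) else 0)"
    have "(\<Sum>a\<in>A. c a * L a z) = 0" if z: "z \<in> R" for z
    proof -
      define w where "w = (\<lambda>h. z h - (\<Sum>a\<in>B. L a z * y a h))"
      have w: "w \<in> R" unfolding w_def using y z by (intro residual_mem) (auto simp: dual_fam_def)
      have Lw: "L i w = L i z - (\<Sum>a\<in>B. L a z * L i (y a))" for i
        unfolding w_def by (rule functional_residual[OF functional])
      have "L a w = 0" if "a \<in> B" for a
      proof -
        have "(\<Sum>x\<in>B. L x z * L a (y x)) = (\<Sum>x\<in>B. L x z * of_bool (x = a))"
          using y that by (intro sum.cong) (auto simp: dual_fam_def)
        then show ?thesis using that fB by (simp add: Lw sum_of_bool_mult)
      qed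
      then have "L b w = 0" using B(3) w b by (auto simp: spans_def)
      then have "L b z - (\<Sum>a\<in>B. L a z * L b (y a)) = 0" by (simp add: Lw)
      moreover have "(\<Sum>a\<in>A. c a * L a z) = (\<Sum>a\<in>insert b B. c a * L a z)"
        using B(1) b assms by (intro sum.mono_neutral_right) (auto simp: c_def)
      moreover have "\<dots> = L b z + (\<Sum>a\<in>B. c a * L a z)" using fB nb by (simp add: c_def)
      moreover have "(\<Sum>a\<in>B. c a * L a z) = (\<Sum>a\<in>B. - (L a z * L b (y a)))"
        using nb by (intro sum.cong) (auto simp: c_def)
      ultimately show ?thesis by (simp add: sum_negf)
    qed
    with ind b have "c b = 0" by blast
    then show False by (simp add: c_def)
  qed
  with B(1) have "B = A" by blast
  then show "indep A" using B(2) by simp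
qed

end

section \<open>Pairings, partitions and integrality\<close>

text \<open>Following \<open>e\<close> and \<open>t\<close> alternately decomposes \<open>H\<close>
  into cycles of even length, which can be coloured alternately. The induction avoids cycles: it
  deletes one pair \<open>{a, e a}\<close> and lets \<open>t'\<close> join the two partners left
  over.\<close>

lemma alternating_sign:
  assumes "finite H"
    and "\<And>h. h \<in> H \<Longrightarrow> e h \<in> H \<and> e (e h) = h \<and> e h \<noteq> h"
    and "\<And>h. h \<in> H \<Longrightarrow> t h \<in> H \<and> t (t h) = h \<and> t h \<noteq> h"
  shows "\<exists>g :: 'h \<Rightarrow> real. \<forall>h\<in>H. g h \<in> {1, -1} \<and> g (e h) = - g h \<and> g (t h) = - g h"
  using assms
proof (induction H arbitrary: t rule: finite_psubset_induct)
  case (psubset H)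
  show ?case
  proof (cases "H = {}")
    case False
    then obtain a where a: "a \<in> H" by blast
    define b where "b = e a"
    have ab: "b \<in> H" "a \<noteq> b" "e b = a" "e a = b" using psubset.prems(1)[OF a] by (auto simp: b_def)
    note ta = psubset.prems(2)[OF a] and tb = psubset.prems(2)[OF ab(1)]
    define H' where "H' = H - {a, b}"
    define t' where "t' = (\<lambda>h. if t h = a then t b else if t h = b then t a else t h)"
    have e': "e h \<in> H' \<and> e (e h) = h \<and> e h \<noteq> h" if "h \<in> H'" for h
      using psubset.prems(1)[of h] that ab by (auto simp: H'_def)
    have t': "t' h \<in> H' \<and> t' (t' h) = h \<and> t' h \<noteq> h" if h: "h \<in> H'" for h
    proof -
      have h': "h \<in> H" "h \<noteq> a" "h \<noteq> b" using h by (auto simp: H'_def)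
      note th = psubset.prems(2)[OF h'(1)]
      consider "t h = a" | "t h = b" | "t h \<noteq> a" "t h \<noteq> b" by blast
      then show ?thesis
      proof cases
        case 1
        then have "t a = h" using th by auto
        moreover have "t b \<noteq> a" "t b \<noteq> b" using calculation tb h' by auto
        ultimately show ?thesis using 1 tb ta h' ab by (auto simp: t'_def H'_def)
      next
        case 2
        then have "t b = h" using th by auto
        moreover have "t a \<noteq> a" "t a \<noteq> b" using calculation ta h' by auto
        ultimately show ?thesis using 2 tb ta h' ab by (auto simp: t'_def H'_def)
      next
        case 3
        then show ?thesis using th h' by (auto simp: t'_def H'_def)
      qed
    qed
    have "H' \<subset> H" using a by (auto simp: H'_def)
    from psubset.IH[OF this e' t'] obtain g :: "'h \<Rightarrow> real" where
      g: "\<forall>h\<in>H'. g h \<in> {1, -1} \<and> g (e h) = - g h \<and> g (t' h) = - g h" by blast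
    \<comment> \<open>If \<open>t a\<close> was deleted, then \<open>t a = b\<close>, the pair is a
      cycle of its own and any sign works. Otherwise \<open>ga\<close> is forced, and
      \<open>t' (t a) = t b\<close> makes it consistent at \<open>b\<close>.\<close>
    define ga where "ga = (if t a \<in> H' then - g (t a) else 1)"
    define g' where "g' = g(a := ga, b := - ga)"
    have "g' h \<in> {1, -1} \<and> g' (e h) = - g' h \<and> g' (t h) = - g' h" if h: "h \<in> H" for h
    proof -
      have ga: "ga \<in> {1, -1}" using g by (auto simp: ga_def)
      have key: "g' a = ga" "g' b = - ga" "\<And>x. x \<in> H' \<Longrightarrow> g' x = g x"
        using ab by (auto simp: g'_def H'_def)
      have ta': "g' (t a) = - ga"
      proof (cases "t a = b")
        case True then show ?thesis using key by simp
      next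
        case False
        then have "t a \<in> H'" using ta by (auto simp: H'_def)
        then show ?thesis using key by (simp add: ga_def)
      qed
      have tb': "g' (t b) = ga"
      proof (cases "t b = a")
        case True then show ?thesis using key by simp
      next
        case False
        then have 1: "t b \<in> H'" using tb by (auto simp: H'_def)
        have "t a \<noteq> b" using False ta by auto
        then have 2: "t a \<in> H'" using ta by (auto simp: H'_def)
        have "t' (t a) = t b" using ta by (simp add: t'_def)
        then have "g (t b) = - g (t a)" using g 2 by metis
        then show ?thesis using key 1 2 by (simp add: ga_def)
      qed
      consider "h = a" | "h = b" | "h \<in> H'" using h by (auto simp: H'_def)
      then show ?thesis
      proof cases
        case 1
        then show ?thesis using key ta' ga ab by auto
      next
        case 2
        then show ?thesis using key tb' ga ab by auto
      next
        case 3
        have eh: "e h \<in> H'" using e'[OF 3] by blast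
        have th: "t h \<in> H" "t (t h) = h" using psubset.prems(2)[OF h] by auto
        consider "t h = a" | "t h = b" | "t h \<in> H'" using th by (auto simp: H'_def)
        then have "g' (t h) = - g' h"
        proof cases
          case 1 then show ?thesis using ta' th key by auto
        next
          case 2 then show ?thesis using tb' th key by auto
        next
          case a: 3
          then have "t' h = t h" by (auto simp: t'_def H'_def)
          then show ?thesis using a 3 g key by metis
        qed
        then show ?thesis using g 3 key eh by auto
      qed
    qed
    then show ?thesis by (intro exI[of _ g']) blast
  qed simp
qed

section \<open>Non-integral values of functions with integral block sums\<close>

lemma card_partition_ge_two:
  assumes "finite N" "partition_on N P" "\<And>p. p \<in> P \<Longrightarrow> 2 \<le> card p"
  shows "2 * card P \<le> card N"
proof -
  have fP: "finite P" using assms finite_elements by blast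
  have "2 * card P = (\<Sum>p\<in>P. 2)" by simp
  also have "\<dots> \<le> sum card P" using assms by (intro sum_mono) auto
  also have "\<dots> = card N"
    using product_partition[OF assms(2)] assms(1,2) by (metis finite_Union finite_subset partition_onD1 Sup_upper)
  finally show ?thesis .
qed

text \<open>
  There are at most \<open>|N|\<close> equations, and one of them is redundant because both partitions give the same
  total sum.
\<close>
lemma two_partitions_kernel:
  assumes "finite N" "N \<noteq> {}" "partition_on N P" "partition_on N Q"
    "\<And>p. p \<in> P \<union> Q \<Longrightarrow> 2 \<le> card p"
  shows "\<exists>z :: 'h \<Rightarrow> real. (\<exists>h\<in>N. z h \<noteq> 0) \<and> (\<forall>h. h \<notin> N \<longrightarrow> z h = 0) \<and> (\<forall>p\<in>P \<union> Q. sum z p = 0)"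
proof -
  have fPQ: "finite P" "finite Q" using assms finite_elements by blast+
  have "2 * card P \<le> card N" "2 * card Q \<le> card N"
    using assms by (auto intro: card_partition_ge_two)
  moreover obtain q where q: "q \<in> Q" using assms(2,4) by (metis Sup_empty all_not_in_conv partition_onD1)
  moreover have "card (P \<union> (Q - {q})) \<le> card P + (card Q - 1)"
    using card_Un_le[of P "Q - {q}"] q fPQ by simp
  moreover have "card Q > 0" using q fPQ by (auto simp: card_gt_0_iff)
  ultimately have "card (P \<union> (Q - {q})) < card N" by linarith
  from homogeneous_system[OF _ assms(1) this, of "\<lambda>p h. of_bool (h \<in> p)"] fPQ obtain c :: "'h \<Rightarrow> real"
    where c: "\<exists>h\<in>N. c h \<noteq> 0" "\<forall>p\<in>P \<union> (Q - {q}). (\<Sum>h\<in>N. c h * of_bool (h \<in> p)) = 0" by auto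
  define z where "z = (\<lambda>h. if h \<in> N then c h else 0)"
  have sub: "p \<subseteq> N" if "p \<in> P \<union> Q" for p
    using that assms(3,4) by (auto simp: partition_on_def)
  have sz: "sum z p = (\<Sum>h\<in>N. c h * of_bool (h \<in> p))" if "p \<in> P \<union> Q" for p
  proof -
    have "(\<Sum>h\<in>N. c h * of_bool (h \<in> p)) = (\<Sum>h\<in>p. c h * of_bool (h \<in> p))"
      using sub[OF that] assms(1) by (intro sum.mono_neutral_right) auto
    also have "\<dots> = sum z p" using sub[OF that] by (intro sum.cong) (auto simp: z_def)
    finally show ?thesis by simp
  qed
  have 0: "sum z p = 0" if "p \<in> P \<union> (Q - {q})" for p
    using c(2) that sz[of p] by auto
  have "sum z q + (\<Sum>p\<in>Q - {q}. sum z p) = (\<Sum>p\<in>P. sum z p)"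
    using sum.partition[OF assms(1,3), of z] sum.partition[OF assms(1,4), of z] fPQ(2) q
    by (simp add: sum.remove)
  then have "sum z q = 0" using 0 by simp
  then have "\<forall>p\<in>P \<union> Q. sum z p = 0" using 0 by blast
  then show ?thesis using c(1) by (intro exI[of _ z]) (auto simp: z_def)
qed

text \<open>A block cannot contain exactly one non-integral value, since its sum is integral. Hence
  both partitions, restricted to the non-integral points \<open>N\<close>, have only blocks of size
  at least two, as \<open>two_partitions_kernel\<close> requires.\<close>

lemma nonintegral_perturbation:
  fixes z :: "'h \<Rightarrow> real"
  assumes "finite H" "partition_on H P" "partition_on H Q"
    and int: "\<And>p. p \<in> P \<union> Q \<Longrightarrow> sum z p \<in> \<int>"
    and ex: "\<exists>h\<in>H. z h \<notin> \<int>"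
  shows "\<exists>w :: 'h \<Rightarrow> real. (\<exists>h\<in>H. w h \<noteq> 0) \<and> (\<forall>h. z h \<in> \<int> \<longrightarrow> w h = 0) \<and>
           (\<forall>h. h \<notin> H \<longrightarrow> w h = 0) \<and> (\<forall>p\<in>P \<union> Q. sum w p = 0)"
proof -
  define N where "N = {h \<in> H. z h \<notin> \<int>}"
  have N: "finite N" "N \<noteq> {}" "N \<subseteq> H" using assms(1) ex by (auto simp: N_def)
  define P' where "P' = (\<inter>) N ` P - {{}}"
  define Q' where "Q' = (\<inter>) N ` Q - {{}}"
  have part: "partition_on N P'" "partition_on N Q'"
    using partition_on_restrict[OF assms(2), of N] partition_on_restrict[OF assms(3), of N] N(3)
    by (auto simp: P'_def Q'_def Int_absorb2)
  have fin: "finite p" "p \<subseteq> H" if "p \<in> P \<union> Q" for p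
    using that assms(1-3) by (auto simp: partition_on_def intro: finite_subset)
  have "2 \<le> card p'" if p': "p' \<in> P' \<union> Q'" for p'
  proof (rule ccontr)
    assume n: "\<not> ?thesis"
    from p' obtain p where p: "p \<in> P \<union> Q" "p' = N \<inter> p" "p' \<noteq> {}" by (auto simp: P'_def Q'_def)
    then have "card p' \<noteq> 0" using N(1) by simp
    then have "card p' = 1" using n by simp
    then obtain h where h: "p' = {h}" by (auto simp: card_1_singleton_iff)
    then have hp: "h \<in> p" "h \<in> N" using p by auto
    have "z x \<in> \<int>" if "x \<in> p - {h}" for x
      using that h p fin(2)[OF p(1)] by (auto simp: N_def)
    then have "sum z (p - {h}) \<in> \<int>" by (rule Ints_sum)
    moreover have "z h = sum z p - sum z (p - {h})"
      using fin(1)[OF p(1)] hp(1) by (simp add: sum.remove)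
    ultimately have "z h \<in> \<int>" using int[OF p(1)] by auto
    then show False using hp by (simp add: N_def)
  qed
  from two_partitions_kernel[OF N(1,2) part this] obtain w :: "'h \<Rightarrow> real" where
    w: "\<exists>h\<in>N. w h \<noteq> 0" "\<forall>h. h \<notin> N \<longrightarrow> w h = 0" "\<forall>p\<in>P' \<union> Q'. sum w p = 0" by blast
  have "sum w p = 0" if p: "p \<in> P \<union> Q" for p
  proof (cases "N \<inter> p = {}")
    case True
    then show ?thesis using w(2) by (intro sum.neutral) auto
  next
    case False
    have "sum w p = sum w (N \<inter> p)"
      using w(2) fin(1)[OF p] by (intro sum.mono_neutral_right) auto
    also have "\<dots> = 0" using w(3) False p by (auto simp: P'_def Q'_def)
    finally show ?thesis .
  qed
  then show ?thesis using w N by (intro exI[of _ w]) (auto simp: N_def)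
qed

section \<open>Determinants of integral matrices with integral inverse\<close>

lemma det_integer:
  fixes A :: "real mat"
  assumes "A \<in> carrier_mat k k" "\<And>i j. i < k \<Longrightarrow> j < k \<Longrightarrow> A $$ (i, j) \<in> \<int>"
  shows "det A \<in> \<int>"
  unfolding det_def'[OF assms(1)]
  by (intro Ints_sum Ints_mult Ints_prod)
     (use assms(2) permutes_in_image in \<open>fastforce simp: sign_def\<close>)+

lemma det_unimodular:
  fixes A B :: "real mat"
  assumes "A \<in> carrier_mat k k" "B \<in> carrier_mat k k" "B * A = 1\<^sub>m k"
    "\<And>i j. i < k \<Longrightarrow> j < k \<Longrightarrow> A $$ (i, j) \<in> \<int>" "\<And>i j. i < k \<Longrightarrow> j < k \<Longrightarrow> B $$ (i, j) \<in> \<int>"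
  shows "det A \<in> {-1, 0, 1}"
proof -
  obtain a b where ab: "det A = of_int a" "det B = of_int b"
    using det_integer[OF assms(1,4)] det_integer[OF assms(2,5)] by (auto simp: Ints_def)
  have "det B * det A = 1" using det_mult[OF assms(2,1)] assms(3) by simp
  then have "b * a = 1" unfolding ab by (metis of_int_mult of_int_eq_1_iff)
  then have "a = 1 \<or> a = -1" by (metis mult.commute zmult_eq_1_iff)
  then show ?thesis using ab by auto
qed

section \<open>Pairings as involutions, and representatives of classes\<close>

lemma pairing_involution:
  assumes "partition_on H P" "\<And>p. p \<in> P \<Longrightarrow> card p = 2"
  obtains e where "\<And>h. h \<in> H \<Longrightarrow> e h \<in> H \<and> e (e h) = h \<and> e h \<noteq> h"
    "\<And>p h. p \<in> P \<Longrightarrow> h \<in> p \<Longrightarrow> p = {h, e h}"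
proof -
  have ex: "\<exists>k. k \<noteq> h \<and> (\<forall>p\<in>P. h \<in> p \<longrightarrow> p = {h, k}) \<and> {h, k} \<in> P" if h: "h \<in> H" for h
  proof -
    obtain p where p: "p \<in> P" "h \<in> p" using h partition_onD1[OF assms(1)] by blast
    then obtain k where k: "p = {h, k}" "h \<noteq> k" using assms(2)[OF p(1)] by (auto simp: card_2_iff)
    have *: "q = p" if "q \<in> P" "h \<in> q" for q
      using disjointD[OF partition_onD2[OF assms(1)] that(1) p(1)] that p by blast
    have "k \<noteq> h" using k(2) by simp
    moreover have "\<forall>q\<in>P. h \<in> q \<longrightarrow> q = {h, k}" unfolding k(1)[symmetric] using * by blast
    moreover have "{h, k} \<in> P" unfolding k(1)[symmetric] by (rule p(1))
    ultimately have "k \<noteq> h \<and> (\<forall>q\<in>P. h \<in> q \<longrightarrow> q = {h, k}) \<and> {h, k} \<in> P" by (intro conjI)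
    then show ?thesis by (rule exI)
  qed
  then obtain e where e: "\<And>h. h \<in> H \<Longrightarrow> e h \<noteq> h \<and> (\<forall>p\<in>P. h \<in> p \<longrightarrow> p = {h, e h}) \<and> {h, e h} \<in> P"
    by metis
  have sub: "p \<subseteq> H" if "p \<in> P" for p using that assms(1) by (auto simp: partition_on_def)
  show ?thesis
  proof (rule that[of e])
    fix h assume h: "h \<in> H"
    have "e h \<in> H" using e[OF h] sub by blast
    moreover have "{h, e h} = {e h, e (e h)}" using e[OF h] e[OF calculation] by blast
    ultimately show "e h \<in> H \<and> e (e h) = h \<and> e h \<noteq> h"
      using e[OF h] by (metis doubleton_eq_iff)
  next
    fix p h assume "p \<in> P" "h \<in> p"
    then show "p = {h, e h}" using e[of h] sub by blast
  qed
qed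

lemma two_pairings_sign:
  assumes "finite H" "partition_on H P" "partition_on H Q" "\<And>p. p \<in> P \<union> Q \<Longrightarrow> card p = 2"
  obtains g :: "'h \<Rightarrow> real" where "\<And>h. h \<in> H \<Longrightarrow> g h = 1 \<or> g h = -1"
    "\<And>p. p \<in> P \<union> Q \<Longrightarrow> sum g p = 0"
proof -
  obtain e where e: "\<And>h. h \<in> H \<Longrightarrow> e h \<in> H \<and> e (e h) = h \<and> e h \<noteq> h"
    "\<And>p h. p \<in> P \<Longrightarrow> h \<in> p \<Longrightarrow> p = {h, e h}"
    by (rule pairing_involution[OF assms(2)]) (use assms(4) in auto)
  obtain t where t: "\<And>h. h \<in> H \<Longrightarrow> t h \<in> H \<and> t (t h) = h \<and> t h \<noteq> h"
    "\<And>p h. p \<in> Q \<Longrightarrow> h \<in> p \<Longrightarrow> p = {h, t h}"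
    by (rule pairing_involution[OF assms(3)]) (use assms(4) in auto)
  from alternating_sign[OF assms(1) e(1) t(1)] obtain g :: "'h \<Rightarrow> real" where
    g: "\<forall>h\<in>H. g h \<in> {1, -1} \<and> g (e h) = - g h \<and> g (t h) = - g h" by blast
  show ?thesis
  proof (rule that[of g])
    fix p assume p: "p \<in> P \<union> Q"
    then have "p \<noteq> {}" using assms(4) by fastforce
    then obtain h where h: "h \<in> p" by blast
    then have H: "h \<in> H" using p assms(2,3) by (auto simp: partition_on_def)
    from p e(2)[of p h] t(2)[of p h] h have "p = {h, e h} \<or> p = {h, t h}" by blast
    then show "sum g p = 0" using e(1)[OF H] t(1)[OF H] g H by auto
  qed (use g in auto)
qed

text \<open>Representatives may be prescribed on a set \<open>B\<close> meeting each class at most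
  once. For circuits, \<open>B\<close> will be the set of roots, so that the circuits without a root
  are counted by a set difference.\<close>

lemma quotient_representatives:
  assumes "equiv A r" "B \<subseteq> A" "\<And>a b. a \<in> B \<Longrightarrow> b \<in> B \<Longrightarrow> (a, b) \<in> r \<Longrightarrow> a = b"
  obtains C where "B \<subseteq> C" "C \<subseteq> A" "\<And>a b. a \<in> C \<Longrightarrow> b \<in> C \<Longrightarrow> (a, b) \<in> r \<Longrightarrow> a = b"
    "\<And>a. a \<in> A \<Longrightarrow> \<exists>c\<in>C. (c, a) \<in> r" "card C = card (A // r)"
proof -
  have "\<exists>c. c \<in> X \<and> (X \<inter> B \<noteq> {} \<longrightarrow> c \<in> B)" if "X \<in> A // r" for X
    using in_quotient_imp_non_empty[OF assms(1) that] by blast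
  then obtain f where f: "\<And>X. X \<in> A // r \<Longrightarrow> f X \<in> X" "\<And>X. X \<in> A // r \<Longrightarrow> X \<inter> B \<noteq> {} \<Longrightarrow> f X \<in> B"
    by metis
  have eq: "X = Y" if "X \<in> A // r" "Y \<in> A // r" "(f X, f Y) \<in> r" for X Y
    using quotient_eqI[OF assms(1) that(1,2) f(1)[OF that(1)] f(1)[OF that(2)] that(3)] .
  have sub: "X \<subseteq> A" if "X \<in> A // r" for X using in_quotient_imp_subset[OF assms(1) that] .
  have rel: "(x, y) \<in> r" if "X \<in> A // r" "x \<in> X" "y \<in> X" for X x y
    using in_quotient_imp_in_rel[OF assms(1) that(1), of x y] that by simp
  have cl: "r `` {a} \<in> A // r" "a \<in> r `` {a}" if "a \<in> A" for a
    using quotientI[OF that] equiv_class_self[OF assms(1) that] by auto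
  show ?thesis
  proof (rule that[of "f ` (A // r)"])
    show "B \<subseteq> f ` (A // r)"
    proof
      fix b assume b: "b \<in> B"
      then have bA: "b \<in> A" using assms(2) by blast
      have fb: "f (r `` {b}) \<in> B" "f (r `` {b}) \<in> r `` {b}"
        using f[OF cl(1)[OF bA]] cl(2)[OF bA] b by auto
      then have "b = f (r `` {b})" using assms(3)[OF b fb(1)] by blast
      then show "b \<in> f ` (A // r)" using cl(1)[OF bA] by blast
    qed
    show "f ` (A // r) \<subseteq> A" using f(1) sub by blast
    show "\<And>a b. a \<in> f ` (A // r) \<Longrightarrow> b \<in> f ` (A // r) \<Longrightarrow> (a, b) \<in> r \<Longrightarrow> a = b"
      using eq by blast
    show "\<exists>c\<in>f ` (A // r). (c, a) \<in> r" if "a \<in> A" for a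
      using rel[OF cl(1)[OF that] f(1)[OF cl(1)[OF that]] cl(2)[OF that]] cl(1)[OF that] by blast
    have "inj_on f (A // r)"
    proof (rule inj_onI)
      fix X Y assume XY: "X \<in> A // r" "Y \<in> A // r" "f X = f Y"
      have "(f X, f X) \<in> r" by (rule rel[OF XY(1) f(1)[OF XY(1)] f(1)[OF XY(1)]])
      then show "X = Y" using eq[OF XY(1,2)] XY(3) by simp
    qed
    then show "card (f ` (A // r)) = card (A // r)" by (rule card_image)
  qed
qed

lemma equiv_Restr_rtrancl:
  assumes "sym (r\<^sup>*)"
  shows "equiv A (Restr (r\<^sup>*) A)"
  using assms by (auto simp: equiv_def refl_on_def sym_def trans_def intro: rtrancl_trans)

section \<open>Transitions and circuits\<close>

locale four_regular_graph =
  fixes F :: "('v, 'h) hgraph"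
  assumes wf: "wf_hgraph F" and reg: "four_regular F"
begin

abbreviation "H \<equiv> halfs F"
abbreviation "V \<equiv> verts F"
abbreviation "\<Omega> \<equiv> skew_classes F"
abbreviation "cls v \<equiv> {t. transition_at F v t}"

lemma finite_H: "finite H" and finite_V: "finite V" and edges_part: "partition_on H (edges F)"
  and card_edge: "p \<in> edges F \<Longrightarrow> card p = 2" and inc_V: "h \<in> H \<Longrightarrow> inc F h \<in> V"
  using wf by (auto simp: wf_hgraph_def)

lemma finite_halfs_at: "finite (halfs_at F v)"
  using finite_H by (simp add: halfs_at_def)

lemma card_halfs_at: "v \<in> V \<Longrightarrow> card (halfs_at F v) = 4"
  using reg by (simp add: four_regular_def)

lemma halfs_at_explicit:
  assumes "v \<in> V" "a \<in> halfs_at F v"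
  obtains b c d where "halfs_at F v = {a, b, c, d}" "distinct [a, b, c, d]"
proof -
  have "card (halfs_at F v - {a}) = 3"
    using assms card_halfs_at finite_halfs_at by simp
  then obtain b c d where "halfs_at F v - {a} = {b, c, d}" "b \<noteq> c" "b \<noteq> d" "c \<noteq> d"
    by (auto simp: card_3_iff)
  then show ?thesis using that[of b c d] assms(2) by auto
qed

lemma transition_at_explicit:
  assumes v: "v \<in> V" "halfs_at F v = {a, b, c, d}" "distinct [a, b, c, d]"
  shows "transition_at F v t \<longleftrightarrow> t = {{a, b}, {c, d}} \<or> t = {{a, c}, {b, d}} \<or> t = {{a, d}, {b, c}}"
proof
  assume "transition_at F v t"
  then obtain s1 s2 where t: "t = {s1, s2}" "single_transition F s1" "single_transition F s2"
    "s1 \<inter> s2 = {}" "s1 \<union> s2 = halfs_at F v" unfolding transition_at_def by blast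
  then obtain p q where s1: "s1 = {p, q}" "p \<noteq> q" by (auto simp: single_transition_def)
  have s2: "s2 = {a, b, c, d} - s1" using t(4,5) v(2) by blast
  have "p \<in> {a, b, c, d}" "q \<in> {a, b, c, d}" using t(5) s1 v(2) by blast+
  then consider "s1 = {a, b}" | "s1 = {a, c}" | "s1 = {a, d}" | "s1 = {b, c}" | "s1 = {b, d}" | "s1 = {c, d}"
    using s1 by (elim insertE emptyE) (simp_all, (metis insert_commute)+)
  then show "t = {{a, b}, {c, d}} \<or> t = {{a, c}, {b, d}} \<or> t = {{a, d}, {b, c}}"
  proof cases
    case 1
    then have "s2 = {c, d}" using s2 v(3) by auto
    then show ?thesis unfolding t(1) 1 by (simp add: insert_commute)
  next
    case 2
    then have "s2 = {b, d}" using s2 v(3) by auto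
    then show ?thesis unfolding t(1) 2 by (simp add: insert_commute)
  next
    case 3
    then have "s2 = {b, c}" using s2 v(3) by auto
    then show ?thesis unfolding t(1) 3 by (simp add: insert_commute)
  next
    case 4
    then have "s2 = {a, d}" using s2 v(3) by auto
    then show ?thesis unfolding t(1) 4 by (simp add: insert_commute)
  next
    case 5
    then have "s2 = {a, c}" using s2 v(3) by auto
    then show ?thesis unfolding t(1) 5 by (simp add: insert_commute)
  next
    case 6
    then have "s2 = {a, b}" using s2 v(3) by auto
    then show ?thesis unfolding t(1) 6 by (simp add: insert_commute)
  qed
next
  have st: "single_transition F {x, y}" if "x \<in> {a, b, c, d}" "y \<in> {a, b, c, d}" "x \<noteq> y" for x y
  proof -
    have "x \<in> halfs_at F v" "y \<in> halfs_at F v" unfolding v(2) by (rule that)+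
    then show ?thesis unfolding single_transition_def halfs_at_def using that(3) by blast
  qed
  have D: "a \<noteq> b" "a \<noteq> c" "a \<noteq> d" "b \<noteq> c" "b \<noteq> d" "c \<noteq> d" using v(3) by auto
  have dj: "{a, b} \<inter> {c, d} = {}" "{a, c} \<inter> {b, d} = {}" "{a, d} \<inter> {b, c} = {}"
    using D by simp_all
  have un: "{a, b} \<union> {c, d} = halfs_at F v" "{a, c} \<union> {b, d} = halfs_at F v"
    "{a, d} \<union> {b, c} = halfs_at F v"
    unfolding v(2) by auto
  have S: "single_transition F {a, b}" "single_transition F {a, c}" "single_transition F {a, d}"
    "single_transition F {b, c}" "single_transition F {b, d}" "single_transition F {c, d}"
    using D by (intro st; simp)+
  assume "t = {{a, b}, {c, d}} \<or> t = {{a, c}, {b, d}} \<or> t = {{a, d}, {b, c}}"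
  then show "transition_at F v t"
    unfolding transition_at_def
  proof (intro conjI v(1), elim disjE)
  qed (rule exI, rule exI, intro conjI, assumption, rule S, rule S, rule dj, rule un)+
qed

text \<open>Relabelling the half-edges other than \<open>a\<close> brings any transition into the
  first of the three forms, which spares later arguments a case distinction.\<close>

lemma transition_atE:
  assumes "transition_at F v t" "a \<in> halfs_at F v"
  obtains b c d where "halfs_at F v = {a, b, c, d}" "distinct [a, b, c, d]" "t = {{a, b}, {c, d}}"
proof -
  have v: "v \<in> V" using assms(1) by (simp add: transition_at_def)
  from halfs_at_explicit[OF v assms(2)] obtain b c d where
    e: "halfs_at F v = {a, b, c, d}" "distinct [a, b, c, d]" .
  have "t = {{a, b}, {c, d}} \<or> t = {{a, c}, {b, d}} \<or> t = {{a, d}, {b, c}}"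
    using assms(1) unfolding transition_at_explicit[OF v e] .
  then show ?thesis
  proof (elim disjE)
    assume t: "t = {{a, b}, {c, d}}"
    show ?thesis by (rule that[OF e t])
  next
    assume t: "t = {{a, c}, {b, d}}"
    show ?thesis by (rule that[OF _ _ t]) (use e in auto)
  next
    assume t: "t = {{a, d}, {b, c}}"
    show ?thesis by (rule that[OF _ _ t]) (use e in auto)
  qed
qed

lemma halfs_at_nonempty: "v \<in> V \<Longrightarrow> halfs_at F v \<noteq> {}"
  using card_halfs_at[of v] by auto

lemma Union_transition: "transition_at F v t \<Longrightarrow> \<Union>t = halfs_at F v"
  by (auto simp: transition_at_def)

lemma transition_at_unique: "transition_at F v t \<Longrightarrow> transition_at F w t \<Longrightarrow> v = w"
  using Union_transition[of v t] Union_transition[of w t] halfs_at_nonempty[of v]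
  by (auto simp: halfs_at_def transition_at_def)

lemma two_transitions:
  assumes "v \<in> V"
  obtains x y where "transition_at F v x" "transition_at F v y" "x \<noteq> y"
proof -
  obtain a where "a \<in> halfs_at F v" using halfs_at_nonempty[OF assms] by blast
  from halfs_at_explicit[OF assms this] obtain b c d where
    e: "halfs_at F v = {a, b, c, d}" "distinct [a, b, c, d]" .
  have "{{a, b}, {c, d}} \<noteq> {{a, c}, {b, d}}"
    using e(2) by (simp add: doubleton_eq_iff)
  then show ?thesis
    by (intro that[of "{{a, b}, {c, d}}" "{{a, c}, {b, d}}"])
      (simp_all add: transition_at_explicit[OF assms e])
qed

lemma single_transition_card:
  assumes "transition_at F v t" "s \<in> t"
  shows "card s = 2" "s \<subseteq> halfs_at F v"
proof -
  obtain s1 s2 where t: "t = {s1, s2}" "single_transition F s1" "single_transition F s2"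
    "s1 \<union> s2 = halfs_at F v" using assms(1) unfolding transition_at_def by blast
  have "s = s1 \<or> s = s2" using assms(2) unfolding t(1) by simp
  then show "s \<subseteq> halfs_at F v" using t(4) by blast
  from \<open>s = s1 \<or> s = s2\<close> have "single_transition F s" using t(2,3) by blast
  then show "card s = 2" unfolding single_transition_def by (metis card_2_iff)
qed

lemma finite_transitions: "finite (transitions F)"
proof -
  have "transitions F \<subseteq> Pow (Pow H)"
    using single_transition_card(2) by (fastforce simp: transitions_def halfs_at_def)
  then show ?thesis using finite_H finite_subset by fastforce
qed

lemma partition_skew: "partition_on (transitions F) \<Omega>"
  unfolding partition_on_def
proof (intro conjI)
  show "\<Union>\<Omega> = transitions F" by (auto simp: skew_classes_def transitions_def transition_at_def)
  show "disjoint \<Omega>" using transition_at_unique by (auto simp: skew_classes_def disjoint_def)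
  show "{} \<notin> \<Omega>"
  proof
    assume "{} \<in> \<Omega>"
    then obtain v where "v \<in> V" "cls v = {}" by (auto simp: skew_classes_def)
    then show False using two_transitions[of v] by blast
  qed
qed

lemma transversalE:
  assumes "transversal \<Omega> T" "v \<in> V"
  obtains t where "T \<inter> cls v = {t}" "t \<in> T" "transition_at F v t"
proof -
  have "card (T \<inter> cls v) = 1" using assms by (auto simp: transversal_def skew_classes_def)
  then obtain t where "T \<inter> cls v = {t}" by (auto simp: card_1_singleton_iff)
  then show ?thesis using that[of t] by blast
qed

lemma transversal_memE:
  assumes "transversal \<Omega> T" "t \<in> T"
  obtains v where "v \<in> V" "transition_at F v t" "T \<inter> cls v = {t}"
proof -
  obtain v where v: "v \<in> V" "transition_at F v t"
    using assms by (auto simp: transversal_def skew_classes_def)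
  obtain t' where t': "T \<inter> cls v = {t'}" by (rule transversalE[OF assms(1) v(1)])
  moreover have "t \<in> T \<inter> cls v" using v(2) assms(2) by simp
  ultimately have "T \<inter> cls v = {t}" by simp
  then show ?thesis by (rule that[OF v])
qed

lemma transversal_update:
  assumes "transversal \<Omega> T" "transition_at F v t"
  shows "transversal \<Omega> (insert t (T - cls v))"
  unfolding transversal_def
proof (intro conjI ballI)
  show "insert t (T - cls v) \<subseteq> \<Union>\<Omega>"
    using assms by (auto simp: transversal_def skew_classes_def transition_at_def)
  fix \<omega> assume "\<omega> \<in> \<Omega>"
  then obtain w where w: "w \<in> V" "\<omega> = cls w" by (auto simp: skew_classes_def)
  show "card (insert t (T - cls v) \<inter> \<omega>) = 1"
  proof (cases "w = v")
    case True
    then have "insert t (T - cls v) \<inter> \<omega> = {t}" using w assms(2) by auto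
    then show ?thesis by simp
  next
    case False
    then have "insert t (T - cls v) \<inter> \<omega> = T \<inter> cls w" using w assms(2) transition_at_unique by blast
    then show ?thesis using \<open>\<omega> \<in> \<Omega>\<close> w(2) assms(1) by (simp add: transversal_def)
  qed
qed

lemma transversal_exists: "\<exists>T. transversal \<Omega> T"
proof -
  have "\<forall>v\<in>V. \<exists>t. transition_at F v t" using two_transitions by blast
  then obtain f where f: "\<And>v. v \<in> V \<Longrightarrow> transition_at F v (f v)" by metis
  have "transversal \<Omega> (f ` V)"
    unfolding transversal_def
  proof (intro conjI ballI)
    show "f ` V \<subseteq> \<Union>\<Omega>" using f by (auto simp: skew_classes_def)
    fix \<omega> assume "\<omega> \<in> \<Omega>"
    then obtain w where w: "w \<in> V" "\<omega> = cls w" by (auto simp: skew_classes_def)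
    have "f ` V \<inter> \<omega> = {f w}" using w f transition_at_unique by blast
    then show "card (f ` V \<inter> \<omega>) = 1" by simp
  qed
  then show ?thesis by blast
qed

lemma card_transversal:
  assumes "transversal \<Omega> T"
  shows "finite T" "card T = card V"
proof -
  define f where "f v = (THE t. t \<in> T \<inter> cls v)" for v
  have f: "T \<inter> cls v = {f v}" if v: "v \<in> V" for v
  proof -
    obtain t where "T \<inter> cls v = {t}" by (rule transversalE[OF assms v])
    then show ?thesis by (simp add: f_def)
  qed
  have f': "f v \<in> T" "transition_at F v (f v)" if "v \<in> V" for v
    using f[OF that] by auto
  have "inj_on f V" by (rule inj_onI) (metis f'(2) transition_at_unique)
  moreover have "T = f ` V"
  proof
    show "T \<subseteq> f ` V"
    proof
      fix t assume t: "t \<in> T"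
      obtain v where v: "v \<in> V" "T \<inter> cls v = {t}" by (rule transversal_memE[OF assms t])
      then have "t = f v" using f[OF v(1)] by simp
      then show "t \<in> f ` V" using v(1) by simp
    qed
    show "f ` V \<subseteq> T" using f' by blast
  qed
  ultimately show "finite T" "card T = card V" using finite_V by (auto simp: card_image)
qed

section \<open>Circuits as alternations of edges and single transitions\<close>

lemma single_transitions_part:
  assumes "transversal \<Omega> T"
  shows "partition_on H (\<Union>T)" "p \<in> \<Union>T \<Longrightarrow> card p = 2"
proof -
  have "s1 = s2" if h: "t1 \<in> T" "t2 \<in> T" "s1 \<in> t1" "s2 \<in> t2" "x \<in> s1" "x \<in> s2" for t1 t2 s1 s2 x
  proof -
    obtain v where v: "transition_at F v t1" "T \<inter> cls v = {t1}" by (rule transversal_memE[OF assms h(1)])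
    obtain w where w: "transition_at F w t2" "T \<inter> cls w = {t2}" by (rule transversal_memE[OF assms h(2)])
    have "x \<in> halfs_at F v" "x \<in> halfs_at F w"
      using h(5,6) single_transition_card(2)[OF v(1) h(3)] single_transition_card(2)[OF w(1) h(4)] by auto
    then have "v = w" by (auto simp: halfs_at_def)
    then have "t1 = t2" using v w by auto
    obtain r1 r2 where r: "t1 = {r1, r2}" "r1 \<inter> r2 = {}" using v(1) unfolding transition_at_def by blast
    have "s1 \<in> {r1, r2}" "s2 \<in> {r1, r2}" using h(3,4) \<open>t1 = t2\<close> unfolding r(1)[symmetric] by auto
    then show ?thesis using r(2) h(5,6) by auto
  qed
  then have "disjoint (\<Union>T)" unfolding disjoint_def by blast
  moreover have "\<Union>(\<Union>T) = H"
  proof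
    show "\<Union>(\<Union>T) \<subseteq> H"
    proof
      fix h assume "h \<in> \<Union>(\<Union>T)"
      then obtain t where t: "t \<in> T" "h \<in> \<Union>t" by blast
      obtain v where "transition_at F v t" by (rule transversal_memE[OF assms t(1)])
      then show "h \<in> H" using t Union_transition by (auto simp: halfs_at_def)
    qed
    show "H \<subseteq> \<Union>(\<Union>T)"
    proof
      fix h assume h: "h \<in> H"
      obtain t where t: "t \<in> T" "transition_at F (inc F h) t" by (rule transversalE[OF assms inc_V[OF h]])
      have "h \<in> \<Union>t" using Union_transition[OF t(2)] h by (simp add: halfs_at_def)
      then show "h \<in> \<Union>(\<Union>T)" using t by blast
    qed
  qed
  moreover have c: "card p = 2" if p: "p \<in> \<Union>T" for p
  proof -
    from p obtain t where t: "t \<in> T" "p \<in> t" by blast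
    obtain v where "transition_at F v t" by (rule transversal_memE[OF assms t(1)])
    then show ?thesis using t single_transition_card by blast
  qed
  moreover have "{} \<notin> \<Union>T" using c by fastforce
  ultimately show "partition_on H (\<Union>T)" "p \<in> \<Union>T \<Longrightarrow> card p = 2" by (auto simp: partition_on_def)
qed

text \<open>The flows along the circuits of \<open>T\<close>: on each circuit such a function is
  determined by one value up to alternating sign, so on \<open>H\<close> these functions have one
  degree of freedom per circuit.\<close>

definition alt :: "'h set set set \<Rightarrow> ('h \<Rightarrow> real) \<Rightarrow> bool" where
  "alt T z \<longleftrightarrow> (\<forall>p\<in>edges F \<union> \<Union>T. sum z p = 0)"

lemma alt_sign:
  assumes "transversal \<Omega> T"
  obtains g where "alt T g" "\<And>h. h \<in> H \<Longrightarrow> g h = 1 \<or> g h = -1"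
proof -
  have "card p = 2" if "p \<in> edges F \<union> \<Union>T" for p
    using card_edge single_transitions_part(2)[OF assms] that by blast
  from two_pairings_sign[OF finite_H edges_part single_transitions_part(1)[OF assms] this]
  show ?thesis using that unfolding alt_def by metis
qed

abbreviation "conn T \<equiv> (circuit_rel F T)\<^sup>*"

lemma circuit_rel_iff: "(a, b) \<in> circuit_rel F T \<longleftrightarrow> {a, b} \<in> edges F \<union> \<Union>T"
  by (auto simp: circuit_rel_def)

lemma sym_conn: "(a, b) \<in> conn T \<Longrightarrow> (b, a) \<in> conn T"
proof -
  have "sym (circuit_rel F T)" by (auto simp: sym_def circuit_rel_iff insert_commute)
  then show "(a, b) \<in> conn T \<Longrightarrow> (b, a) \<in> conn T" by (metis sym_rtrancl symD)
qed

lemma pair_props: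
  assumes "transversal \<Omega> T" "p \<in> edges F \<union> \<Union>T"
  shows "card p = 2" "p \<subseteq> H"
  using assms card_edge single_transitions_part[OF assms(1)] edges_part
  by (auto simp: partition_on_def)

lemma circuit_relD:
  assumes "transversal \<Omega> T" "(a, b) \<in> circuit_rel F T"
  shows "a \<noteq> b" "a \<in> H" "b \<in> H" "alt T z \<Longrightarrow> z b = - z a"
proof -
  have p: "card {a, b} = 2" "{a, b} \<subseteq> H"
    using pair_props[OF assms(1)] assms(2) by (auto simp: circuit_rel_iff)
  then show "a \<noteq> b" "a \<in> H" "b \<in> H" by auto
  then show "alt T z \<Longrightarrow> z b = - z a" using assms(2) unfolding alt_def circuit_rel_iff by force
qed

lemma conn_alt:
  assumes "transversal \<Omega> T" "(a, b) \<in> conn T" "alt T z" "alt T w"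
  shows "\<bar>z a\<bar> = \<bar>z b\<bar>" "z a * w a = z b * w b"
  using assms(2)
  by (induction rule: rtrancl_induct) (auto simp: circuit_relD(4)[OF assms(1) _ assms(3)] circuit_relD(4)[OF assms(1) _ assms(4)])

lemma alt_iff:
  assumes "transversal \<Omega> T"
  shows "alt T z \<longleftrightarrow> (\<forall>a b. (a, b) \<in> circuit_rel F T \<longrightarrow> z b = - z a)"
proof
  show "alt T z \<Longrightarrow> \<forall>a b. (a, b) \<in> circuit_rel F T \<longrightarrow> z b = - z a"
    using circuit_relD(4)[OF assms] by blast
  assume R: "\<forall>a b. (a, b) \<in> circuit_rel F T \<longrightarrow> z b = - z a"
  show "alt T z" unfolding alt_def
  proof
    fix p assume p: "p \<in> edges F \<union> \<Union>T"
    obtain a b where ab: "p = {a, b}" "a \<noteq> b" using pair_props(1)[OF assms p] by (auto simp: card_2_iff)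
    then have "z b = - z a" using R p by (auto simp: circuit_rel_iff)
    then show "sum z p = 0" using ab by simp
  qed
qed

lemma alt_restrict:
  assumes "transversal \<Omega> T" "alt T z"
  shows "alt T (\<lambda>h. if (a, h) \<in> conn T then z h else 0)"
  unfolding alt_iff[OF assms(1)]
proof (intro allI impI)
  fix x y assume xy: "(x, y) \<in> circuit_rel F T"
  have "(y, x) \<in> conn T" using sym_conn[of x y] xy by blast
  then have "(a, x) \<in> conn T \<longleftrightarrow> (a, y) \<in> conn T"
    using xy by (meson r_into_rtrancl rtrancl_trans)
  then show "(if (a, y) \<in> conn T then z y else 0) = - (if (a, x) \<in> conn T then z x else 0)"
    using circuit_relD(4)[OF assms(1) xy assms(2)] by auto
qed

text \<open>An edge moves to an adjacent vertex and a single transition stays at its vertex, so a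
  circuit remains inside one component. Consequently two different roots never share a
  circuit.\<close>

lemma conn_adj:
  assumes "transversal \<Omega> T" "(a, b) \<in> conn T"
  shows "(inc F a, inc F b) \<in> (adj_rel F)\<^sup>*"
  using assms(2)
proof (induction rule: rtrancl_induct)
  case (step b c)
  have "(inc F b, inc F c) \<in> (adj_rel F)\<^sup>*"
  proof (cases "{b, c} \<in> edges F")
    case True
    then show ?thesis by (auto simp: adj_rel_def)
  next
    case False
    then obtain t where t: "t \<in> T" "{b, c} \<in> t" using step.hyps by (auto simp: circuit_rel_iff)
    obtain v where "transition_at F v t" by (rule transversal_memE[OF assms(1) t(1)])
    then have "{b, c} \<subseteq> halfs_at F v" using t single_transition_card by blast
    then show ?thesis by (auto simp: halfs_at_def)
  qed
  with step.IH show ?case by (rule rtrancl_trans)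
qed simp

lemma alt_scale: "alt T z \<Longrightarrow> alt T (\<lambda>h. c * z h)"
  by (simp add: alt_def flip: sum_distrib_left)

lemma alt_normalized_sign:
  assumes "transversal \<Omega> T" "a \<in> H"
  obtains g where "alt T g" "g a = 1" "\<forall>h\<in>H. g h = 1 \<or> g h = -1"
proof -
  obtain g where g: "alt T g" "\<And>h. h \<in> H \<Longrightarrow> g h = 1 \<or> g h = -1"
    by (rule alt_sign[OF assms(1)]) blast
  show ?thesis
  proof (rule that[of "\<lambda>h. g a * g h"])
    show "alt T (\<lambda>h. g a * g h)" by (rule alt_scale[OF g(1)])
    show "g a * g a = 1" using g(2)[OF assms(2)] by auto
    show "\<forall>h\<in>H. g a * g h = 1 \<or> g a * g h = -1"
      using g(2)[OF assms(2)] g(2) by fastforce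
  qed
qed

lemma alt_update:
  "alt (insert t (T - cls v)) z \<longleftrightarrow>
     (\<forall>p\<in>edges F \<union> \<Union>(T - cls v). sum z p = 0) \<and> (\<forall>p\<in>t. sum z p = 0)"
  by (auto simp: alt_def)

text \<open>
  If all three transitions at \<open>v\<close> led to a single circuit through \<open>v\<close>, the sum of the circuit
  orientations of two of them would vanish on exactly two of the half-edges at \<open>v\<close> and still alternate
  along the circuit of one of the three transitions, although it must have constant modulus there.
\<close>
lemma splitting_transition:
  assumes T: "transversal \<Omega> T" and v: "v \<in> V"
  obtains a b c d where "halfs_at F v = {a, b, c, d}" "distinct [a, b, c, d]"
    "(a, c) \<notin> conn (insert {{a, b}, {c, d}} (T - cls v))"
proof -
  obtain a where a: "a \<in> halfs_at F v" using halfs_at_nonempty[OF v] by blast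
  obtain b c d where hv: "halfs_at F v = {a, b, c, d}" and dist: "distinct [a, b, c, d]"
    by (rule halfs_at_explicit[OF v a])
  define T2 where "T2 = insert {{a, b}, {c, d}} (T - cls v)"
  define T3 where "T3 = insert {{a, c}, {b, d}} (T - cls v)"
  define T4 where "T4 = insert {{a, d}, {b, c}} (T - cls v)"
  have tr: "transversal \<Omega> T2" "transversal \<Omega> T3" "transversal \<Omega> T4"
    unfolding T2_def T3_def T4_def
    by (rule transversal_update[OF T]; simp add: transition_at_explicit[OF v hv dist])+
  have D: "a \<noteq> b" "a \<noteq> c" "a \<noteq> d" "b \<noteq> c" "b \<noteq> d" "c \<noteq> d" using dist by auto
  have HH: "a \<in> H" "b \<in> H" "c \<in> H" "d \<in> H" using hv by (auto simp: halfs_at_def)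
  show ?thesis
  proof (rule ccontr)
    assume no: "\<not> ?thesis"
    \<comment> \<open>Permuting the labels \<open>b\<close>, \<open>c\<close>, \<open>d\<close>
      applies the denied statement to all three transitions at \<open>v\<close>.\<close>
    have "(a, c) \<in> conn T2"
      using no that[OF hv dist] unfolding T2_def by blast
    moreover have "(a, b) \<in> conn T3"
      using no that[of a c b d] hv D unfolding T3_def by (auto simp: insert_commute)
    moreover have "(a, b) \<in> conn T4"
      using no that[of a d b c] hv D unfolding T4_def by (auto simp: insert_commute)
    ultimately have key: "alt T2 z \<Longrightarrow> \<bar>z a\<bar> = \<bar>z c\<bar>" "alt T3 z \<Longrightarrow> \<bar>z a\<bar> = \<bar>z b\<bar>"
      "alt T4 z \<Longrightarrow> \<bar>z a\<bar> = \<bar>z b\<bar>" for z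
      using conn_alt(1)[OF tr(1)] conn_alt(1)[OF tr(2)] conn_alt(1)[OF tr(3)] by blast+
    obtain g2 where g2: "alt T2 g2" "g2 a = 1" "\<forall>h\<in>H. g2 h = 1 \<or> g2 h = -1"
      by (rule alt_normalized_sign[OF tr(1) HH(1)])
    obtain g3 where g3: "alt T3 g3" "g3 a = 1" "\<forall>h\<in>H. g3 h = 1 \<or> g3 h = -1"
      by (rule alt_normalized_sign[OF tr(2) HH(1)])
    obtain g4 where g4: "alt T4 g4" "g4 a = 1" "\<forall>h\<in>H. g4 h = 1 \<or> g4 h = -1"
      by (rule alt_normalized_sign[OF tr(3) HH(1)])
    have off: "sum g2 p = 0" "sum g3 p = 0" "sum g4 p = 0" if "p \<in> edges F \<union> \<Union>(T - cls v)" for p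
      using g2(1) g3(1) g4(1) that unfolding T2_def T3_def T4_def alt_update by blast+
    have v2: "g2 b = -1" "g2 d = - g2 c" and v3: "g3 c = -1" "g3 d = - g3 b"
      and v4: "g4 d = -1" "g4 c = - g4 b"
      using g2(1,2) g3(1,2) g4(1,2) D unfolding T2_def T3_def T4_def alt_update by auto
    \<comment> \<open>Away from \<open>v\<close> the three alternation conditions coincide, so a sum
      satisfying them there only has to be tested on its four values at \<open>v\<close>.\<close>
    have 2: "alt T2 z \<longleftrightarrow> z a + z b = 0 \<and> z c + z d = 0"
      and 3: "alt T3 z \<longleftrightarrow> z a + z c = 0 \<and> z b + z d = 0"
      and 4: "alt T4 z \<longleftrightarrow> z a + z d = 0 \<and> z b + z c = 0"
      if "\<And>p. p \<in> edges F \<union> \<Union>(T - cls v) \<Longrightarrow> sum z p = 0" for z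
      using that D unfolding T2_def T3_def T4_def alt_update by auto
    have o24: "sum (\<lambda>h. g2 h + g4 h) p = 0" and o34: "sum (\<lambda>h. g3 h + g4 h) p = 0"
      if "p \<in> edges F \<union> \<Union>(T - cls v)" for p
      using off[OF that] by (simp_all add: sum.distrib)
    show False
    \<comment> \<open>On \<open>(a, b, c, d)\<close> the signs are \<open>(1, -1, x, -x)\<close> for
      \<open>g2\<close>, \<open>(1, u, -1, -u)\<close> for \<open>g3\<close> and
      \<open>(1, w, -w, -1)\<close> for \<open>g4\<close>. In each case the chosen sum is
      \<open>2\<close> at \<open>a\<close>, \<open>-2\<close> at one other half-edge and
      \<open>0\<close> at the remaining two.\<close>
    proof (cases "g4 b = 1")
      case True
      show False
      proof (cases "g2 c = 1")
        case c: True
        have "alt T4 (\<lambda>h. g2 h + g4 h)" using 4[OF o24] True c v2 v4 g2(2) g4(2) by simp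
        from key(3)[OF this] show False using True v2 g2(2) g4(2) by simp
      next
        case False
        then have c: "g2 c = -1" using g2(3) HH(3) by auto
        have "alt T3 (\<lambda>h. g2 h + g4 h)" using 3[OF o24] True c v2 v4 g2(2) g4(2) by simp
        from key(2)[OF this] show False using True v2 g2(2) g4(2) by simp
      qed
    next
      case False
      then have b: "g4 b = -1" using g4(3) HH(2) by auto
      show False
      proof (cases "g3 b = 1")
        case c: True
        have "alt T4 (\<lambda>h. g3 h + g4 h)" using 4[OF o34] b c v3 v4 g3(2) g4(2) by simp
        from key(3)[OF this] show False using b c g3(2) g4(2) by simp
      next
        case False
        then have c: "g3 b = -1" using g3(3) HH(2) by auto
        have "alt T2 (\<lambda>h. g3 h + g4 h)" using 2[OF o34] b c v3 v4 g3(2) g4(2) by simp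
        from key(1)[OF this] show False using b v3 v4 g3(2) g4(2) by simp
      qed
    qed
  qed
qed

lemma alt_vertex:
  assumes "transversal \<Omega> T" "alt T z" "v \<in> V"
  shows "sum z (halfs_at F v) = 0"
proof -
  obtain t where t: "t \<in> T" "transition_at F v t" by (rule transversalE[OF assms(1,3)])
  obtain a where a: "a \<in> halfs_at F v" using halfs_at_nonempty[OF assms(3)] by blast
  obtain b c d where e: "halfs_at F v = {a, b, c, d}" "distinct [a, b, c, d]" "t = {{a, b}, {c, d}}"
    by (rule transition_atE[OF t(2) a])
  have "\<forall>p\<in>t. sum z p = 0" using assms(2) t(1) unfolding alt_def by blast
  then have "sum z {a, b} = 0" "sum z {c, d} = 0" unfolding e(3) by blast+
  then show ?thesis using e by simp
qed

section \<open>Choice of a root half-edge in every component\<close>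

lemma sym_adj: "sym ((adj_rel F)\<^sup>*)"
proof -
  have "sym (adj_rel F)" unfolding adj_rel_def sym_def by simp (metis insert_commute)
  then show ?thesis by (rule sym_rtrancl)
qed

lemma component_roots:
  obtains E0 where "E0 \<subseteq> H" "inj_on (inc F) E0" "card E0 = num_components F"
    "\<And>a b. a \<in> E0 \<Longrightarrow> b \<in> E0 \<Longrightarrow> (inc F a, inc F b) \<in> (adj_rel F)\<^sup>* \<Longrightarrow> a = b"
    "\<And>v. v \<in> V \<Longrightarrow> \<exists>e\<in>E0. (inc F e, v) \<in> (adj_rel F)\<^sup>*"
proof -
  obtain C where C: "C \<subseteq> V" "\<And>a b. a \<in> C \<Longrightarrow> b \<in> C \<Longrightarrow> (a, b) \<in> Restr ((adj_rel F)\<^sup>*) V \<Longrightarrow> a = b"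
    "\<And>a. a \<in> V \<Longrightarrow> \<exists>c\<in>C. (c, a) \<in> Restr ((adj_rel F)\<^sup>*) V" "card C = num_components F"
    by (rule quotient_representatives[OF equiv_Restr_rtrancl[OF sym_adj], of "{}" V])
      (auto simp: num_components_def)
  have "\<forall>v\<in>C. \<exists>h. h \<in> halfs_at F v" using halfs_at_nonempty C(1) by blast
  then obtain f where f: "\<And>v. v \<in> C \<Longrightarrow> f v \<in> halfs_at F v" by metis
  have f': "f v \<in> H" "inc F (f v) = v" if "v \<in> C" for v using f[OF that] by (auto simp: halfs_at_def)
  show ?thesis
  proof (rule that[of "f ` C"])
    show "f ` C \<subseteq> H" using f' by blast
    show "inj_on (inc F) (f ` C)" using f' by (auto intro!: inj_onI)
    have "inj_on f C" using f'(2) by (intro inj_onI) metis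
    then show "card (f ` C) = num_components F" using C(4) by (simp add: card_image)
    show "a = b" if ab: "a \<in> f ` C" "b \<in> f ` C" "(inc F a, inc F b) \<in> (adj_rel F)\<^sup>*" for a b
    proof -
      obtain x y where xy: "x \<in> C" "y \<in> C" "a = f x" "b = f y" using ab(1,2) by blast
      then have "(x, y) \<in> Restr ((adj_rel F)\<^sup>*) V" using ab(3) f' C(1) by auto
      then show "a = b" using C(2) xy by blast
    qed
    show "\<exists>e\<in>f ` C. (inc F e, v) \<in> (adj_rel F)\<^sup>*" if "v \<in> V" for v
      using C(3)[OF that] f' by auto
  qed
qed

section \<open>Uniqueness of the Eulerian multimatroid\<close>

lemma subtransversalI: "transversal \<Omega> T \<Longrightarrow> S \<subseteq> T \<Longrightarrow> subtransversal \<Omega> S"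
  by (auto simp: subtransversal_def)

lemma subtransversal_subset: "subtransversal \<Omega> S \<Longrightarrow> A \<subseteq> S \<Longrightarrow> subtransversal \<Omega> A"
  by (auto simp: subtransversal_def)

lemma subtransversal_card:
  assumes "subtransversal \<Omega> S"
  shows "finite S" "card S \<le> card V"
proof -
  obtain T where "transversal \<Omega> T" "S \<subseteq> T" using assms by (auto simp: subtransversal_def)
  then show "finite S" "card S \<le> card V" using card_transversal[of T] finite_subset card_mono by metis+
qed

lemma subtransversal_transitions: "subtransversal \<Omega> S \<Longrightarrow> S \<subseteq> transitions F"
  using partition_onD1[OF partition_skew] by (auto simp: subtransversal_def transversal_def)

lemma subtransversal_insert:
  assumes "subtransversal \<Omega> S" "\<omega> \<in> \<Omega>" "\<omega> \<inter> S = {}" "x \<in> \<omega>"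
  shows "subtransversal \<Omega> (insert x S)"
proof -
  obtain T where T: "transversal \<Omega> T" "S \<subseteq> T" using assms(1) by (auto simp: subtransversal_def)
  obtain v where v: "\<omega> = cls v" using assms(2) by (auto simp: skew_classes_def)
  have "transversal \<Omega> (insert x (T - cls v))"
    using transversal_update[OF T(1)] assms(4) v by simp
  then show ?thesis by (rule subtransversalI) (use T(2) assms(3) v in auto)
qed

lemma subtransversal_cases:
  assumes "subtransversal \<Omega> S"
  obtains "transversal \<Omega> S"
  | \<omega> x y where "\<omega> \<in> \<Omega>" "\<omega> \<inter> S = {}" "x \<in> \<omega>" "y \<in> \<omega>" "x \<noteq> y"
proof (cases "\<exists>v\<in>V. cls v \<inter> S = {}")
  case True
  then obtain v where v: "v \<in> V" "cls v \<inter> S = {}" by blast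
  obtain x y where xy: "transition_at F v x" "transition_at F v y" "x \<noteq> y"
    by (rule two_transitions[OF v(1)])
  show ?thesis by (rule that(2)[of "cls v" x y]) (use v xy in \<open>auto simp: skew_classes_def\<close>)
next
  case False
  obtain T where T: "transversal \<Omega> T" "S \<subseteq> T" using assms by (auto simp: subtransversal_def)
  have "T \<subseteq> S"
  proof
    fix t assume t: "t \<in> T"
    obtain v where v: "v \<in> V" "T \<inter> cls v = {t}" by (rule transversal_memE[OF T(1) t])
    obtain u where u: "u \<in> cls v" "u \<in> S" using False v(1) by blast
    then have "u \<in> T \<inter> cls v" using T(2) by blast
    then show "t \<in> S" using u(2) unfolding v(2) by simp
  qed
  then have "S = T" using T(2) by blast
  then show ?thesis using that(1) T(1) by blast
qed

text \<open>Submodularity lets one element raise the rank by at most one, and the axiom forces one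
  of the two to raise it. So the rank of \<open>S\<close> can be recovered from larger
  subtransversals.\<close>

lemma multimatroid_step:
  assumes "multimatroid (transitions F) \<Omega> r" "subtransversal \<Omega> S"
    "\<omega> \<in> \<Omega>" "\<omega> \<inter> S = {}" "x \<in> \<omega>" "y \<in> \<omega>" "x \<noteq> y"
  shows "max (r (insert x S)) (r (insert y S)) = r S + 1"
proof -
  have le: "r (insert u S) \<le> r S + 1" if u: "u \<in> \<omega>" for u
  proof -
    have "subtransversal \<Omega> (insert u S)" by (rule subtransversal_insert[OF assms(2-4) u])
    then have m: "matroid_rank_on (insert u S) r" using assms(1) by (simp add: multimatroid_def)
    then have "r (S \<union> {u}) + r (S \<inter> {u}) \<le> r S + r {u}"
      by (intro matroid_rank_onD(3)) auto
    moreover have "r {u} \<le> card {u}" using m by (intro matroid_rank_onD(1)) auto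
    ultimately show ?thesis by simp
  qed
  have "max (r (insert x S)) (r (insert y S)) > r S"
    using assms unfolding multimatroid_def by blast
  then show ?thesis using le[OF assms(5)] le[OF assms(6)] by linarith
qed

text \<open>Induction over the number of skew classes that \<open>S\<close> misses, starting from
  the transversals and descending by \<open>multimatroid_step\<close>.\<close>

lemma multimatroid_unique:
  assumes "multimatroid (transitions F) \<Omega> r" "multimatroid (transitions F) \<Omega> r'"
    "\<And>T. transversal \<Omega> T \<Longrightarrow> r T = r' T" "subtransversal \<Omega> S"
  shows "r S = r' S"
  using assms(4)
proof (induction "card V - card S" arbitrary: S rule: less_induct)
  case less
  from less.prems show ?case
  proof (cases rule: subtransversal_cases)
    case 1
    then show ?thesis by (rule assms(3))
  next
    case (2 \<omega> x y)
    have IH: "r (insert u S) = r' (insert u S)" if u: "u \<in> \<omega>" for u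
    proof (rule less.hyps)
      show s: "subtransversal \<Omega> (insert u S)" by (rule subtransversal_insert[OF less.prems 2(1,2) u])
      have "u \<notin> S" using 2(2) u by blast
      then have "card (insert u S) = card S + 1" using subtransversal_card[OF less.prems] by simp
      then show "card V - card (insert u S) < card V - card S"
        using subtransversal_card(2)[OF s] by linarith
    qed
    show ?thesis
      using multimatroid_step[OF assms(1) less.prems 2] multimatroid_step[OF assms(2) less.prems 2]
        IH[OF 2(3)] IH[OF 2(4)] by simp
  qed
qed

text \<open>Greedy growth by \<open>multimatroid_step\<close>. For \<open>n = card V\<close> this
  gives a transversal of full rank without constructing an Eulerian circuit in each
  component.\<close>

lemma multimatroid_full_rank:
  assumes "multimatroid (transitions F) \<Omega> r" "n \<le> card V"
  shows "\<exists>S. subtransversal \<Omega> S \<and> card S = n \<and> r S = n"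
  using assms(2)
proof (induction n)
  case 0
  have s: "subtransversal \<Omega> {}" using transversal_exists by (auto simp: subtransversal_def)
  then have "matroid_rank_on {} r" using assms(1) by (simp add: multimatroid_def)
  from matroid_rank_onD(1)[OF this, of "{}"] have "r {} \<le> card {}" by simp
  then show ?case using s by (intro exI[of _ "{}"]) simp
next
  case (Suc n)
  then obtain S where S: "subtransversal \<Omega> S" "card S = n" "r S = n" by auto
  from S(1) show ?case
  proof (cases rule: subtransversal_cases)
    case 1
    then show ?thesis using card_transversal(2)[of S] S(2) Suc.prems by simp
  next
    case (2 \<omega> x y)
    have "max (r (insert x S)) (r (insert y S)) = Suc n"
      using multimatroid_step[OF assms(1) S(1) 2] S(3) by simp
    then obtain u where u: "u \<in> \<omega>" "r (insert u S) = Suc n" using 2(3,4)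
      by (metis max_def)
    have "u \<notin> S" using 2(2) u(1) by blast
    then have "card (insert u S) = Suc n" using subtransversal_card[OF S(1)] S(2) by simp
    then show ?thesis using u subtransversal_insert[OF S(1) 2(1,2) u(1)] by blast
  qed
qed

lemma euler_rank_eqI:
  assumes "multimatroid (transitions F) \<Omega> r"
    "\<And>T. transversal \<Omega> T \<Longrightarrow>
        int (r T) = int (card V) - (int (num_circuits F T) - int (num_components F))"
    "\<And>S. \<not> subtransversal \<Omega> S \<Longrightarrow> r S = 0"
  shows "euler_rank F = r"
  unfolding euler_rank_def
proof (rule the_equality)
  fix r' assume r': "multimatroid (transitions F) \<Omega> r' \<and>
     (\<forall>T. transversal \<Omega> T \<longrightarrow>
        int (r' T) = int (card V) - (int (num_circuits F T) - int (num_components F))) \<and>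
     (\<forall>S. \<not> subtransversal \<Omega> S \<longrightarrow> r' S = 0)"
  show "r' = r"
  proof
    fix S
    show "r' S = r S"
    proof (cases "subtransversal \<Omega> S")
      case True
      have "r' T = r T" if "transversal \<Omega> T" for T
      proof -
        have "int (r' T) = int (r T)" using r' assms(2)[OF that] that by metis
        then show ?thesis by simp
      qed
      then show ?thesis using multimatroid_unique[OF _ assms(1) _ True, of r'] r' by blast
    next
      case False
      then show ?thesis using r' assms(3) by simp
    qed
  qed
qed (use assms in blast)

end

section \<open>The flow space\<close>

locale rooted_four_regular_graph = four_regular_graph F
  for F :: "('v, 'h) hgraph" +
  fixes E0 :: "'h set"
  assumes E0_H: "E0 \<subseteq> H"
    and inj_E0: "inj_on (inc F) E0"
    and card_E0: "card E0 = num_components F"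
    and E0_eq: "a \<in> E0 \<Longrightarrow> b \<in> E0 \<Longrightarrow> (inc F a, inc F b) \<in> (adj_rel F)\<^sup>* \<Longrightarrow> a = b"
    and E0_ex: "v \<in> V \<Longrightarrow> \<exists>e\<in>E0. (inc F e, v) \<in> (adj_rel F)\<^sup>*"
begin

text \<open>Functions live on the whole type \<open>'h\<close> and are unconstrained outside
  \<open>H\<close>, so uniqueness and expansion statements about flows hold on \<open>H\<close>
  only.\<close>

definition flows :: "('h \<Rightarrow> real) set" where
  "flows = {z. (\<forall>p\<in>edges F. sum z p = 0) \<and> (\<forall>v\<in>V. sum z (halfs_at F v) = 0) \<and> (\<forall>h\<in>E0. z h = 0)}"

text \<open>One index type holds the transition functionals and the values at half-edges, so that
  bases of one kind can be exchanged against the other. On flows, the choice of a single transition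
  in \<open>t\<close> affects only the sign, because the net flows through the two add up to
  zero.\<close>

definition coord :: "'h set set + 'h \<Rightarrow> ('h \<Rightarrow> real) \<Rightarrow> real" where
  "coord i z = (case i of Inl t \<Rightarrow> sum z (SOME s. s \<in> t) | Inr h \<Rightarrow> z h)"

lemma coord_simps [simp]: "coord (Inl t) z = sum z (SOME s. s \<in> t)" "coord (Inr h) z = z h"
  by (simp_all add: coord_def)

sublocale fl: functional_family flows coord
proof
  fix i show "functional (coord i)"
    by (cases i) (simp_all add: coord_def functional_def sum.distrib sum_distrib_left)
qed (auto simp: flows_def sum.distrib simp flip: sum_distrib_left)

lemma coord_transition:
  assumes "transition_at F v t" "sum z (halfs_at F v) = 0" "s \<in> t"
  shows "sum z s = coord (Inl t) z \<or> sum z s = - coord (Inl t) z"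
proof -
  define q where "q = (SOME s. s \<in> t)"
  have q: "q \<in> t" unfolding q_def using assms(3) by (rule someI)
  obtain s1 s2 where t: "t = {s1, s2}" "s1 \<inter> s2 = {}" "s1 \<union> s2 = halfs_at F v"
    using assms(1) unfolding transition_at_def by blast
  have "finite s1" "finite s2" using t(3) finite_halfs_at[of v] by (metis finite_Un)+
  then have "sum z s1 + sum z s2 = 0" using t(2,3) assms(2) by (metis sum.union_disjoint)
  moreover have "s = s1 \<or> s = s2" "q = s1 \<or> q = s2" using assms(3) q unfolding t(1) by simp_all
  ultimately show ?thesis unfolding coord_simps q_def[symmetric] by auto
qed

lemma flow_alt_iff:
  assumes "transversal \<Omega> T" "z \<in> flows"
  shows "alt T z \<longleftrightarrow> (\<forall>t\<in>T. coord (Inl t) z = 0)"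
proof
  assume a: "alt T z"
  show "\<forall>t\<in>T. coord (Inl t) z = 0"
  proof
    fix t assume t: "t \<in> T"
    obtain v where "transition_at F v t" by (rule transversal_memE[OF assms(1) t])
    then obtain s where "s \<in> t" unfolding transition_at_def by blast
    then have "(SOME s. s \<in> t) \<in> t" by (rule someI)
    then show "coord (Inl t) z = 0" using a t unfolding alt_def coord_simps by blast
  qed
next
  assume c: "\<forall>t\<in>T. coord (Inl t) z = 0"
  show "alt T z" unfolding alt_def
  proof
    fix p assume p: "p \<in> edges F \<union> \<Union>T"
    show "sum z p = 0"
    proof (cases "p \<in> edges F")
      case True
      then show ?thesis using assms(2) by (simp add: flows_def)
    next
      case False
      then obtain t where t: "t \<in> T" "p \<in> t" using p by blast
      obtain v where v: "v \<in> V" "transition_at F v t" by (rule transversal_memE[OF assms(1) t(1)])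
      have "sum z (halfs_at F v) = 0" using assms(2) v(1) by (simp add: flows_def)
      then show ?thesis using coord_transition[OF v(2) _ t(2), of z] c t(1) by auto
    qed
  qed
qed

lemma alt_flow:
  assumes "transversal \<Omega> T" "alt T z" "\<And>e. e \<in> E0 \<Longrightarrow> z e = 0"
  shows "z \<in> flows"
  using assms alt_vertex[OF assms(1,2)] by (auto simp: flows_def alt_def)

text \<open>By \<open>splitting_transition\<close>, some transition \<open>t\<close> at
  \<open>v\<close> leaves two different circuits through \<open>v\<close>, in the same component.
  Its root lies on at most one of them, so the flow along the other is admissible. At
  \<open>v\<close> that flow lives on only one of the two pairs of \<open>t\<close>, hence is
  detected by the other two transitions, and one of \<open>x\<close>, \<open>y\<close> differs from
  \<open>t\<close>.\<close>

lemma rank_increase: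
  assumes "subtransversal \<Omega> S" "\<omega> \<in> \<Omega>" "\<omega> \<inter> S = {}" "x \<in> \<omega>" "y \<in> \<omega>" "x \<noteq> y"
  obtains z where "z \<in> flows" "\<And>t. t \<in> S \<Longrightarrow> coord (Inl t) z = 0"
    "coord (Inl x) z \<noteq> 0 \<or> coord (Inl y) z \<noteq> 0"
proof -
  obtain T where T: "transversal \<Omega> T" "S \<subseteq> T" using assms(1) by (auto simp: subtransversal_def)
  obtain v where v: "v \<in> V" "\<omega> = cls v" using assms(2) by (auto simp: skew_classes_def)
  obtain a b c d where hv: "halfs_at F v = {a, b, c, d}" "distinct [a, b, c, d]"
    and nc: "(a, c) \<notin> conn (insert {{a, b}, {c, d}} (T - cls v))"
    by (rule splitting_transition[OF T(1) v(1)])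
  define t where "t = {{a, b}, {c, d}}"
  define T' where "T' = insert t (T - cls v)"
  have vt: "transition_at F v t" by (simp add: transition_at_explicit[OF v(1) hv] t_def)
  have T': "transversal \<Omega> T'" unfolding T'_def by (rule transversal_update[OF T(1) vt])
  have ST': "S \<subseteq> T'" using T(2) assms(3) v(2) by (auto simp: T'_def)
  have tT': "t \<in> T'" by (simp add: T'_def)
  obtain g where g: "alt T' g" "\<forall>h\<in>H. g h = 1 \<or> g h = -1"
    by (rule alt_sign[OF T']) blast
  have D: "a \<noteq> b" "a \<noteq> c" "a \<noteq> d" "b \<noteq> c" "b \<noteq> d" "c \<noteq> d" using hv(2) by auto
  have HH: "a \<in> H" "c \<in> H" "inc F a = v" "inc F c = v" using hv(1) by (auto simp: halfs_at_def)
  have mem: "{a, b} \<in> \<Union>T'" "{c, d} \<in> \<Union>T'" using tT' unfolding t_def by blast+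
  then have ab: "(a, b) \<in> conn T'" and cd: "(c, d) \<in> conn T'"
    by (simp_all add: circuit_rel_iff r_into_rtrancl)
  have ac: "(a, c) \<notin> conn T'" using nc by (simp add: T'_def t_def)
  have ad: "(a, d) \<notin> conn T'" "(c, a) \<notin> conn T'" "(c, b) \<notin> conn T'"
    using ac ab cd sym_conn rtrancl_trans by metis+
  define za where "za = (\<lambda>h. if (a, h) \<in> conn T' then g h else 0)"
  define zc where "zc = (\<lambda>h. if (c, h) \<in> conn T' then g h else 0)"
  have alt: "alt T' za" "alt T' zc"
    unfolding za_def zc_def by (rule alt_restrict[OF T' g(1)])+
  have eq: "e = e'" if "e \<in> E0" "e' \<in> E0" "(a, e) \<in> conn T'" "(c, e') \<in> conn T'" for e e'
  proof -
    have "(inc F e, v) \<in> (adj_rel F)\<^sup>*" "(v, inc F e') \<in> (adj_rel F)\<^sup>*"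
      using conn_adj[OF T' that(3)] conn_adj[OF T' that(4)] sym_adj HH by (auto dest: symD)
    then show ?thesis using E0_eq[OF that(1,2)] rtrancl_trans by metis
  qed
  have "(\<forall>e\<in>E0. za e = 0) \<or> (\<forall>e\<in>E0. zc e = 0)"
  proof (rule ccontr)
    assume "\<not> ?thesis"
    then obtain e e' where ee: "e \<in> E0" "e' \<in> E0" "(a, e) \<in> conn T'" "(c, e') \<in> conn T'"
      by (auto simp: za_def zc_def split: if_splits)
    then have "(c, e) \<in> conn T'" using eq by blast
    then have "(a, c) \<in> conn T'" using ee(3) sym_conn rtrancl_trans by metis
    then show False using ac by simp
  qed
  then obtain z where z: "alt T' z" "\<forall>e\<in>E0. z e = 0" "z = za \<or> z = zc" using alt by blast
  have zf: "z \<in> flows" using alt_flow[OF T' z(1)] z(2) by blast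
  have sumv: "sum z (halfs_at F v) = 0" by (rule alt_vertex[OF T' z(1) v(1)])
  have vals: "z a \<noteq> 0 \<and> z c = 0 \<and> z d = 0 \<and> z b \<noteq> 0 \<or> z c \<noteq> 0 \<and> z a = 0 \<and> z b = 0 \<and> z d \<noteq> 0"
  proof -
    have "sum z {a, b} = 0" "sum z {c, d} = 0" using z(1) mem unfolding alt_def by blast+
    then have "z a + z b = 0" "z c + z d = 0" using D by simp_all
    moreover have "z a \<noteq> 0 \<and> z c = 0 \<or> z c \<noteq> 0 \<and> z a = 0"
      using z(3) g(2) HH ac ad by (auto simp: za_def zc_def)
    ultimately show ?thesis by auto
  qed
  have nz: "coord (Inl u) z \<noteq> 0" if u: "transition_at F v u" "u \<noteq> t" for u
  proof -
    have "u = {{a, c}, {b, d}} \<or> u = {{a, d}, {b, c}}"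
      using u unfolding transition_at_explicit[OF v(1) hv] t_def by simp
    then obtain s where s: "s \<in> u" "sum z s \<noteq> 0"
    proof (elim disjE)
      assume u: "u = {{a, c}, {b, d}}"
      have "sum z {a, c} \<noteq> 0" using vals D by auto
      then show ?thesis using that[of "{a, c}"] u by simp
    next
      assume u: "u = {{a, d}, {b, c}}"
      have "sum z {a, d} \<noteq> 0" using vals D by auto
      then show ?thesis using that[of "{a, d}"] u by simp
    qed
    then show ?thesis using coord_transition[OF u(1) sumv s(1)] by auto
  qed
  have "\<And>t. t \<in> S \<Longrightarrow> coord (Inl t) z = 0" using flow_alt_iff[OF T' zf] z(1) ST' by blast
  moreover have "coord (Inl x) z \<noteq> 0 \<or> coord (Inl y) z \<noteq> 0"
    using nz[of x] nz[of y] assms(4-6) v(2) by auto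
  ultimately show ?thesis using that zf by blast
qed

text \<open>The basis is dual to a maximal independent set of half-edge values, so the coordinates
  of a flow are some of its own values. The integrality argument depends on this.\<close>

lemma basis_exists:
  obtains X y where "X \<subseteq> H" "fl.indep (Inr ` X)" "fl.spans (Inr ` X) (Inr ` H)"
    "\<And>f. f \<in> X \<Longrightarrow> y f \<in> flows" "\<And>f g. f \<in> X \<Longrightarrow> g \<in> X \<Longrightarrow> y f g = of_bool (f = g)"
proof -
  obtain A where A: "A \<subseteq> Inr ` H" "fl.indep A" "fl.spans A (Inr ` H)"
    by (rule fl.indep_extend[OF _ empty_subsetI fl.indep_empty, of "Inr ` H"]) (use finite_H in auto)
  obtain X where X: "X \<subseteq> H" "A = Inr ` X" using A(1) by (auto simp: subset_image_iff)
  from A(2) obtain y where y: "fl.dual_fam A y" by (auto simp: fl.indep_def)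
  show ?thesis
  proof (rule that[of X "\<lambda>f. y (Inr f)"])
    show "fl.indep (Inr ` X)" "fl.spans (Inr ` X) (Inr ` H)" using A X by auto
  qed (use X y in \<open>auto simp: fl.dual_fam_def\<close>)
qed

text \<open>
  A basis of \<open>T\<close> together with the values at one half-edge of each circuit avoiding \<open>E0\<close> is another
  coordinate system of the flow space.
\<close>
lemma rank_formula:
  assumes T: "transversal \<Omega> T"
    and X: "X \<subseteq> H" "fl.indep (Inr ` X)" "fl.spans (Inr ` X) (Inr ` H)"
  shows "fl.rk (Inl ` T) + num_circuits F T = card X + num_components F"
proof -
  have "sym (conn T)" using sym_conn by (auto simp: sym_def)
  then have equiv: "equiv H (Restr (conn T) H)" by (rule equiv_Restr_rtrancl)
  obtain C where C: "E0 \<subseteq> C" "C \<subseteq> H" "\<And>a b. a \<in> C \<Longrightarrow> b \<in> C \<Longrightarrow> (a, b) \<in> Restr (conn T) H \<Longrightarrow> a = b"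
    "\<And>a. a \<in> H \<Longrightarrow> \<exists>c\<in>C. (c, a) \<in> Restr (conn T) H" "card C = num_circuits F T"
    by (rule quotient_representatives[OF equiv E0_H])
      (use E0_eq conn_adj[OF T] in \<open>auto simp: num_circuits_def\<close>)
  \<comment> \<open>\<open>Q\<close> marks the circuits that avoid the roots. Each root represents
    its own circuit, so \<open>Q\<close> has |P| - c(F) elements.\<close>
  define Q where "Q = C - E0"
  have fin: "finite C" "finite E0" "finite Q" "finite X" "finite T"
    using C(1,2) E0_H X(1) finite_H card_transversal[OF T] by (auto simp: Q_def intro: finite_subset)
  have cQ: "card Q + num_components F = num_circuits F T"
    using card_Diff_subset[OF fin(2) C(1)] card_mono[OF fin(1) C(1)] C(5) card_E0 by (simp add: Q_def)
  have Ceq: "a = b" if "a \<in> C" "b \<in> C" "(a, b) \<in> conn T" for a b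
    using C(3)[OF that(1,2)] that C(2) by auto
  obtain g where g: "alt T g" "\<forall>h\<in>H. g h = 1 \<or> g h = -1"
    by (rule alt_sign[OF T]) blast
  \<comment> \<open>The unit flow around the circuit of \<open>q\<close>: it is killed by
    \<open>T\<close> and vanishes at all other representatives, in particular at the roots if
    \<open>q\<close> is in \<open>Q\<close>.\<close>
  define zq where "zq = (\<lambda>q h. if (q, h) \<in> conn T then g h else 0)"
  have zq_alt: "alt T (zq q)" for q unfolding zq_def by (rule alt_restrict[OF T g(1)])
  have zq_C: "zq q c = 0" if "q \<in> C" "c \<in> C" "q \<noteq> c" for q c
    using Ceq[OF that(1,2)] that(3) by (auto simp: zq_def)
  have zq_q: "zq q q \<noteq> 0" if "q \<in> C" for q
    using bspec[OF g(2), of q] that C(2) by (auto simp: zq_def)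
  have zq_flow: "zq q \<in> flows" if "q \<in> Q" for q
    by (rule alt_flow[OF T zq_alt]) (use that zq_C C(1) in \<open>auto simp: Q_def\<close>)
  have zq_T: "coord (Inl t) (zq q) = 0" if "q \<in> Q" "t \<in> T" for q t
    using flow_alt_iff[OF T zq_flow[OF that(1)]] zq_alt that(2) by blast
  have fT: "finite (Inl ` T :: ('h set set + 'h) set)" using fin by simp
  obtain A where A: "A \<subseteq> Inl ` T" "fl.indep A" "fl.spans A (Inl ` T)"
    by (rule fl.indep_extend[OF fT empty_subsetI fl.indep_empty])
  have fA: "finite A" using A(1) fT finite_subset by blast
  define Y where "Y = A \<union> Inr ` Q"
  have disj: "A \<inter> Inr ` Q = {}" using A(1) by auto
  have fY: "finite Y" using fA fin by (simp add: Y_def)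
  have sumY: "(\<Sum>i\<in>Y. k i) = (\<Sum>i\<in>A. k i) + (\<Sum>q\<in>Q. k (Inr q))" for k :: "'h set set + 'h \<Rightarrow> real"
    unfolding Y_def using fA fin disj by (simp add: sum.union_disjoint sum.reindex)
  have "fl.indep Y"
    unfolding fl.indep_iff[OF fY]
  proof (intro allI impI)
    fix k assume k: "\<forall>z\<in>flows. (\<Sum>i\<in>Y. k i * coord i z) = 0"
    \<comment> \<open>Evaluated at \<open>zq q\<close>, a linear relation retains only the term of
      \<open>q\<close>.\<close>
    have kq: "k (Inr q) = 0" if q: "q \<in> Q" for q
    proof -
      have "(\<Sum>i\<in>A. k i * coord i (zq q)) = 0"
        using A(1) zq_T[OF q] by (intro sum.neutral) auto
      moreover have "(\<Sum>q'\<in>Q. k (Inr q') * zq q q') = k (Inr q) * zq q q"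
      proof -
        have "(\<Sum>q'\<in>Q. k (Inr q') * zq q q') = (\<Sum>q'\<in>{q}. k (Inr q') * zq q q')"
          using q zq_C fin(3) by (intro sum.mono_neutral_right) (auto simp: Q_def)
        then show ?thesis by simp
      qed
      moreover have "(\<Sum>i\<in>Y. k i * coord i (zq q)) = 0" using k zq_flow[OF q] by blast
      ultimately have "k (Inr q) * zq q q = 0" unfolding sumY by simp
      then show ?thesis using zq_q q by (auto simp: Q_def)
    qed
    then have "\<forall>z\<in>flows. (\<Sum>i\<in>A. k i * coord i z) = 0" using k unfolding sumY by simp
    then have "\<forall>i\<in>A. k i = 0" using A(2) unfolding fl.indep_iff[OF fA] by blast
    then show "\<forall>i\<in>Y. k i = 0" using kq by (auto simp: Y_def)
  qed
  moreover have YH: "fl.spans Y (Inr ` H)"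
    unfolding fl.spans_def
  proof (intro ballI impI)
    fix z and s :: "'h set set + 'h"
    assume z: "z \<in> flows" "\<forall>i\<in>Y. coord i z = 0" and s: "s \<in> Inr ` H"
    then obtain h where h: "s = Inr h" "h \<in> H" by blast
    have "\<forall>i\<in>Inl ` T. coord i z = 0"
      using A(3) z unfolding fl.spans_def Y_def by blast
    \<comment> \<open>Vanishing on all of \<open>T\<close> makes \<open>z\<close> alternate, so its
      modulus is constant on each circuit and is zero once it is zero at the representative.\<close>
    then have al: "alt T z" unfolding flow_alt_iff[OF T z(1)] by blast
    obtain c where c: "c \<in> C" "(c, h) \<in> conn T" using C(4)[OF h(2)] by blast
    have "z c = 0"
    proof (cases "c \<in> E0")
      case True then show ?thesis using z(1) by (simp add: flows_def)
    next
      case False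
      then have "Inr c \<in> Y" using c(1) by (simp add: Y_def Q_def)
      then show ?thesis using z(2) coord_simps(2) by metis
    qed
    then show "coord s z = 0" using conn_alt(1)[OF T c(2) al al] h(1) by simp
  qed
  moreover have "fl.spans (Inr ` X) Y"
    unfolding fl.spans_def
  proof (intro ballI impI)
    fix z and s :: "'h set set + 'h"
    assume z: "z \<in> flows" "\<forall>i\<in>Inr ` X. coord i z = 0" and s: "s \<in> Y"
    have zH: "z h = 0" if "h \<in> H" for h
      using X(3) z that unfolding fl.spans_def by fastforce
    have "alt T z" unfolding alt_def
    proof
      fix p assume "p \<in> edges F \<union> \<Union>T"
      then show "sum z p = 0" using pair_props(2)[OF T] zH by (intro sum.neutral) blast
    qed
    then have "\<forall>t\<in>T. coord (Inl t) z = 0" using flow_alt_iff[OF T z(1)] by blast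
    then show "coord s z = 0" using s A(1) C(2) zH by (auto simp: Y_def Q_def)
  qed
  moreover have "fl.spans Y (Inr ` X)" using YH X(1) unfolding fl.spans_def by blast
  ultimately have "card Y = card (Inr ` X :: ('h set set + 'h) set)"
    using fl.card_indep_le[of Y "Inr ` X"] fl.card_indep_le[of "Inr ` X" Y] X(2) fY fin
    by (simp add: le_antisym)
  moreover have "card Y = card A + card Q"
    unfolding Y_def using fA fin disj by (simp add: card_Un_disjoint card_image)
  moreover have "fl.rk (Inl ` T) = card A" by (rule fl.rk_eqI[OF fT A])
  ultimately show ?thesis using cQ by (simp add: card_image)
qed

text \<open>The value \<open>0\<close> off subtransversals matches the normalisation in
  \<open>euler_rank\<close>.\<close>

definition rank :: "'h set set set \<Rightarrow> nat" where
  "rank S = (if subtransversal \<Omega> S then fl.rk (Inl ` S) else 0)"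

lemma matroid_rank:
  assumes "subtransversal \<Omega> S"
  shows "matroid_rank_on S rank"
proof -
  have r: "rank A = fl.rk (Inl ` A)" if "A \<subseteq> S" for A
    using subtransversal_subset[OF assms that] by (simp add: rank_def)
  have fin: "finite (Inl ` S :: ('h set set + 'h) set)" using subtransversal_card[OF assms] by simp
  note m = matroid_rank_onD[OF fl.matroid_rank_rk[OF fin]]
  show ?thesis
    unfolding matroid_rank_on_def
  proof (intro conjI allI impI)
    fix A assume A: "A \<subseteq> S"
    have "card (Inl ` A :: ('h set set + 'h) set) = card A" by (rule card_image) simp
    moreover have "fl.rk (Inl ` A) \<le> card (Inl ` A :: ('h set set + 'h) set)"
      using A by (intro m(1) image_mono)
    ultimately show "rank A \<le> card A" using r[OF A] by simp
  next
    fix A B assume AB: "A \<subseteq> B \<and> B \<subseteq> S"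
    then have "fl.rk (Inl ` A) \<le> fl.rk (Inl ` B)" by (intro m(2) image_mono) auto
    then show "rank A \<le> rank B" using r[of A] r[of B] AB by auto
  next
    fix A B assume AB: "A \<subseteq> S \<and> B \<subseteq> S"
    then have "fl.rk (Inl ` A \<union> Inl ` B) + fl.rk (Inl ` A \<inter> Inl ` B) \<le> fl.rk (Inl ` A) + fl.rk (Inl ` B)"
      by (intro m(3) image_mono) auto
    moreover have "Inl ` A \<union> Inl ` B = (Inl ` (A \<union> B) :: ('h set set + 'h) set)"
      "Inl ` A \<inter> Inl ` B = (Inl ` (A \<inter> B) :: ('h set set + 'h) set)" by auto
    ultimately have "fl.rk (Inl ` (A \<union> B)) + fl.rk (Inl ` (A \<inter> B)) \<le> fl.rk (Inl ` A) + fl.rk (Inl ` B)"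
      by (simp only:)
    moreover have "A \<union> B \<subseteq> S" "A \<inter> B \<subseteq> S" using AB by auto
    ultimately show "rank (A \<union> B) + rank (A \<inter> B) \<le> rank A + rank B" using r AB by simp
  qed
qed

lemma multimatroid_rank: "multimatroid (transitions F) \<Omega> rank"
  unfolding multimatroid_def
proof (intro conjI allI impI)
  show "finite (transitions F)" by (rule finite_transitions)
  show "partition_on (transitions F) \<Omega>" by (rule partition_skew)
  show "matroid_rank_on S rank" if "subtransversal \<Omega> S" for S by (rule matroid_rank[OF that])
  fix S \<omega> x y
  assume h: "subtransversal \<Omega> S \<and> \<omega> \<in> \<Omega> \<and> \<omega> \<inter> S = {} \<and> x \<in> \<omega> \<and> y \<in> \<omega> \<and> x \<noteq> y"
  then obtain z where z: "z \<in> flows" "\<And>t. t \<in> S \<Longrightarrow> coord (Inl t) z = 0"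
    "coord (Inl x) z \<noteq> 0 \<or> coord (Inl y) z \<noteq> 0"
    by (metis rank_increase)
  have fin: "finite (Inl ` S :: ('h set set + 'h) set)" using subtransversal_card h by simp
  have inc: "rank (insert u S) > rank S" if "u \<in> \<omega>" "coord (Inl u) z \<noteq> 0" for u
  proof -
    have "fl.rk (insert (Inl u) (Inl ` S)) > fl.rk (Inl ` S)"
      by (rule fl.rk_insert[OF fin z(1) _ that(2)]) (use z(2) in auto)
    moreover have "subtransversal \<Omega> (insert u S)" using subtransversal_insert h that(1) by blast
    ultimately show ?thesis using h by (simp add: rank_def)
  qed
  show "max (rank (insert x S)) (rank (insert y S)) > rank S"
    using z(3) inc[of x] inc[of y] h by (auto simp: less_max_iff_disj)
qed

section \<open>Upper bound for the dimension of the flow space\<close>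

lemma antisym_vanish:
  assumes "\<forall>p\<in>edges F. sum z p = (0::real)" "\<And>p. p \<in> edges F \<Longrightarrow> \<exists>h\<in>p. z h = 0" "h \<in> H"
  shows "z h = 0"
proof -
  obtain p where p: "p \<in> edges F" "h \<in> p" using assms(3) partition_onD1[OF edges_part] by blast
  obtain h' where h': "h' \<in> p" "z h' = 0" using assms(2)[OF p(1)] by blast
  show ?thesis
  proof (cases "h' = h")
    case False
    obtain x y where xy: "p = {x, y}" "x \<noteq> y" using card_edge[OF p(1)] by (auto simp: card_2_iff)
    have "z x + z y = 0" using assms(1) p(1) xy by auto
    moreover have "h = x \<and> h' = y \<or> h = y \<and> h' = x" using p(2) h'(1) False xy by auto
    ultimately show ?thesis using h'(2) by auto
  qed (use h' in simp)
qed

text \<open>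
  Dimension count in the space of antisymmetric functions, of dimension \<open>2 |V|\<close>: the net flows at the
  non-root vertices, the values at the roots and the coordinates in \<open>X\<close> are independent.
\<close>
lemma basis_card_le:
  assumes X: "X \<subseteq> H" "fl.indep (Inr ` X)"
  shows "card X \<le> card V"
proof -
  define AN :: "('h \<Rightarrow> real) set" where "AN = {z. \<forall>p\<in>edges F. sum z p = 0}"
  define cA :: "'v + 'h \<Rightarrow> ('h \<Rightarrow> real) \<Rightarrow> real" where
    "cA = (\<lambda>i z. case i of Inl v \<Rightarrow> sum z (halfs_at F v) | Inr h \<Rightarrow> z h)"
  have cA [simp]: "cA (Inl v) z = sum z (halfs_at F v)" "cA (Inr h) z = z h" for v h z
    by (simp_all add: cA_def)
  interpret an: functional_family AN cA
  proof
    show "functional (cA i)" for i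
      by (cases i) (simp_all add: functional_def sum.distrib sum_distrib_left)
  qed (auto simp: AN_def sum.distrib simp flip: sum_distrib_left)
  obtain y where y: "fl.dual_fam (Inr ` X) y" using X(2) by (auto simp: fl.indep_def)
  define b where "b f = y (Inr f)" for f
  have b: "b f \<in> flows" "g \<in> X \<Longrightarrow> b f g = of_bool (f = g)" if "f \<in> X" for f g
    using y that by (auto simp: fl.dual_fam_def b_def)
  have EX: "E0 \<inter> X = {}"
  proof (rule ccontr)
    assume "E0 \<inter> X \<noteq> {}"
    then obtain f where f: "f \<in> E0" "f \<in> X" by blast
    then show False using b[OF f(2)] by (auto simp: flows_def)
  qed
  \<comment> \<open>The net flow at one vertex per component is left out, since for antisymmetric
    functions the net flows of a component add up to zero.\<close>
  define W where "W = V - inc F ` E0"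
  define Y where "Y = Inl ` W \<union> Inr ` (E0 \<union> X)"
  have fin: "finite W" "finite E0" "finite X" "finite Y"
    using finite_V finite_H X(1) E0_H by (auto simp: W_def Y_def intro: finite_subset)
  have sumY: "(\<Sum>i\<in>Y. k i * cA i z) = (\<Sum>v\<in>W. k (Inl v) * sum z (halfs_at F v))
      + ((\<Sum>h\<in>E0. k (Inr h) * z h) + (\<Sum>h\<in>X. k (Inr h) * z h))" for k z
  proof -
    have "(\<Sum>i\<in>Y. k i * cA i z) = (\<Sum>i\<in>Inl ` W. k i * cA i z) + (\<Sum>i\<in>Inr ` (E0 \<union> X). k i * cA i z)"
      unfolding Y_def using fin by (intro sum.union_disjoint) auto
    then show ?thesis using fin EX by (simp add: sum.reindex sum.union_disjoint)
  qed
  have "an.indep Y"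
    unfolding an.indep_iff[OF fin(4)]
  proof (intro allI impI)
    fix k assume k: "\<forall>z\<in>AN. (\<Sum>i\<in>Y. k i * cA i z) = 0"
    \<comment> \<open>A normalised flow has no net flow at any vertex and vanishes at the roots, so
      the dual flow \<open>b f\<close> isolates \<open>k (Inr f)\<close>.\<close>
    have kX: "k (Inr f) = 0" if f: "f \<in> X" for f
    proof -
      have 1: "b f \<in> AN" using b(1)[OF f] by (simp add: flows_def AN_def)
      have "(\<Sum>v\<in>W. k (Inl v) * sum (b f) (halfs_at F v)) = 0" "(\<Sum>h\<in>E0. k (Inr h) * b f h) = 0"
        using b(1)[OF f] by (auto simp: flows_def W_def intro!: sum.neutral)
      moreover have "(\<Sum>h\<in>X. k (Inr h) * b f h) = (\<Sum>h\<in>X. k (Inr h) * of_bool (f = h))"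
        using b(2)[OF f] by (intro sum.cong) auto
      ultimately show ?thesis using bspec[OF k 1] f fin(3) unfolding sumY by (simp add: sum_of_bool_mult)
    qed
    have kE: "k (Inr e) = 0" if e: "e \<in> E0" for e
    proof -
      obtain T where T: "transversal \<Omega> T" using transversal_exists by blast
      obtain g where g: "alt T g" "\<forall>h\<in>H. g h = 1 \<or> g h = -1"
        by (rule alt_sign[OF T]) blast
      \<comment> \<open>The circuit through \<open>e\<close> of any transversal carries no net flow
        and meets no other root, so it isolates \<open>k (Inr e)\<close>.\<close>
      define z where "z = (\<lambda>h. if (e, h) \<in> conn T then g h else 0)"
      have za: "alt T z" unfolding z_def by (rule alt_restrict[OF T g(1)])
      have 1: "z \<in> AN" using za by (simp add: AN_def alt_def)
      have "(\<Sum>v\<in>W. k (Inl v) * sum z (halfs_at F v)) = 0"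
        using alt_vertex[OF T za] by (auto simp: W_def intro!: sum.neutral)
      moreover have "(\<Sum>h\<in>X. k (Inr h) * z h) = 0" using kX by simp
      moreover have "(\<Sum>h\<in>E0. k (Inr h) * z h) = (\<Sum>h\<in>{e}. k (Inr h) * z h)"
        using e fin(2) E0_eq[OF e] conn_adj[OF T] by (intro sum.mono_neutral_right) (auto simp: z_def)
      ultimately have "k (Inr e) * z e = 0" using bspec[OF k 1] unfolding sumY by simp
      moreover have "z e \<noteq> 0" using bspec[OF g(2), of e] e E0_H by (auto simp: z_def)
      ultimately show ?thesis by simp
    qed
    \<comment> \<open>Only the vertex terms are left. Test functions supported on a single edge show
      that the coefficients agree at its two ends, with \<open>0\<close> standing in at the root
      vertices; so they vanish throughout each component.\<close>
    define \<kappa> where "\<kappa> v = (if v \<in> W then k (Inl v) else 0)" for v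
    have step: "\<kappa> u = \<kappa> w" if "(u, w) \<in> adj_rel F" for u w
    proof -
      obtain p q where pq: "{p, q} \<in> edges F" "u = inc F p" "w = inc F q"
        using \<open>(u, w) \<in> adj_rel F\<close> by (auto simp: adj_rel_def)
      have ne: "p \<noteq> q" using card_edge[OF pq(1)] by auto
      have pH: "p \<in> H" "q \<in> H" using pq(1) partition_onD1[OF edges_part] by auto
      define z :: "'h \<Rightarrow> real" where "z = (\<lambda>h. of_bool (h = p) - of_bool (h = q))"
      have sz: "sum z A = of_bool (p \<in> A) - of_bool (q \<in> A)" if "finite A" for A
        using that by (simp add: z_def sum_subtractf of_bool_def)
      have "z \<in> AN" unfolding AN_def mem_Collect_eq
      proof
        fix e assume e: "e \<in> edges F"
        have fe: "finite e" using card_edge[OF e] by (simp add: card_ge_0_finite)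
        have "p \<in> e \<longleftrightarrow> q \<in> e"
          using disjointD[OF partition_onD2[OF edges_part] e pq(1)] by blast
        then show "sum z e = 0" using sz[OF fe] by simp
      qed
      then have "(\<Sum>v\<in>W. k (Inl v) * sum z (halfs_at F v)) = 0"
        using k kX kE unfolding sumY by auto
      moreover have "sum z (halfs_at F v) = of_bool (u = v) - of_bool (w = v)" for v
        using sz[OF finite_halfs_at] pH pq by (simp add: halfs_at_def)
      ultimately have "(\<Sum>v\<in>W. k (Inl v) * of_bool (u = v)) - (\<Sum>v\<in>W. k (Inl v) * of_bool (w = v)) = 0"
        by (simp add: right_diff_distrib sum_subtractf)
      moreover have "(\<Sum>v\<in>W. k (Inl v) * of_bool (x = v)) = \<kappa> x" for x
      proof (cases "x \<in> W")
        case True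
        then show ?thesis using fin(1) by (simp add: sum_of_bool_mult \<kappa>_def)
      next
        case False
        then show ?thesis by (auto simp: \<kappa>_def intro!: sum.neutral)
      qed
      ultimately show ?thesis by simp
    qed
    have const: "\<kappa> u = \<kappa> w" if "(u, w) \<in> (adj_rel F)\<^sup>*" for u w
      using that by (induction rule: rtrancl_induct) (auto dest: step)
    have kW: "k (Inl v) = 0" if v: "v \<in> W" for v
    proof -
      obtain e where e: "e \<in> E0" "(inc F e, v) \<in> (adj_rel F)\<^sup>*"
        using E0_ex[of v] v by (auto simp: W_def)
      have "inc F e \<notin> W" using e(1) by (auto simp: W_def)
      then show ?thesis using const[OF e(2)] v by (simp add: \<kappa>_def)
    qed
    show "\<forall>i\<in>Y. k i = 0" using kX kE kW by (auto simp: Y_def)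
  qed
  \<comment> \<open>One half-edge of each edge determines an antisymmetric function on
    \<open>H\<close>. As there are at most 2|V| edges, this bounds the
    \<open>card V + card X\<close> independent functionals of \<open>Y\<close>.\<close>
  define R' where "R' = (\<lambda>p. SOME h. h \<in> p) ` edges F"
  have finE: "finite (edges F)" using finite_elements[OF finite_H edges_part] .
  have some: "(SOME h. h \<in> p) \<in> p" if "p \<in> edges F" for p
  proof -
    have "p \<noteq> {}" using card_edge[OF that] by auto
    then show ?thesis by (simp add: some_in_eq)
  qed
  have "an.spans (Inr ` R') Y"
    unfolding an.spans_def
  proof (intro ballI impI)
    fix z i assume z: "z \<in> AN" "\<forall>a\<in>Inr ` R'. cA a z = 0" and i: "i \<in> Y"
    have zH: "z h = 0" if "h \<in> H" for h
    proof (rule antisym_vanish[OF _ _ that])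
      show "\<forall>p\<in>edges F. sum z p = 0" using z(1) by (simp add: AN_def)
      show "\<exists>h\<in>p. z h = 0" if "p \<in> edges F" for p
        using some[OF that] z(2) that by (auto simp: R'_def)
    qed
    show "cA i z = 0"
      using i zH X(1) E0_H by (auto simp: Y_def halfs_at_def intro!: sum.neutral)
  qed
  then have "card Y \<le> card (Inr ` R' :: ('v + 'h) set)"
    using \<open>an.indep Y\<close> fin(4) finE by (intro an.card_indep_le) (auto simp: R'_def)
  also have "\<dots> \<le> card (edges F)"
    unfolding R'_def image_image using finE by (rule card_image_le)
  finally have "card Y \<le> card (edges F)" .
  moreover have "2 * card (edges F) \<le> card H"
    by (rule card_partition_ge_two[OF finite_H edges_part]) (simp add: card_edge)
  moreover have "card H \<le> 4 * card V"
  proof -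
    have "H = (\<Union>v\<in>V. halfs_at F v)" using inc_V by (auto simp: halfs_at_def)
    then have "card H \<le> (\<Sum>v\<in>V. card (halfs_at F v))" using card_UN_le[OF finite_V] by metis
    then show ?thesis using card_halfs_at by simp
  qed
  moreover have "card Y = card W + (card E0 + card X)"
  proof -
    have "card Y = card (Inl ` W :: ('v + 'h) set) + card (Inr ` (E0 \<union> X) :: ('v + 'h) set)"
      unfolding Y_def using fin by (intro card_Un_disjoint) auto
    then show ?thesis using fin EX by (simp add: card_image card_Un_disjoint)
  qed
  moreover have "card W + card E0 = card V"
  proof -
    have sub: "inc F ` E0 \<subseteq> V" using E0_H inc_V by auto
    have "card W = card V - card E0"
      unfolding W_def using card_Diff_subset[OF _ sub] fin(2) card_image[OF inj_E0] by simp
    moreover have "card E0 \<le> card V" using card_mono[OF finite_V sub] card_image[OF inj_E0] by simp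
    ultimately show ?thesis by simp
  qed
  ultimately show ?thesis by linarith
qed

section \<open>Total unimodularity\<close>

text \<open>By \<open>uniq\<close>, the integral values and integral transition coordinates of
  \<open>z\<close> leave no freedom. The split graph is encoded as a second partition
  \<open>Q\<close> of the half-edges beside the edges; a nonzero perturbation supported on the
  non-integral half-edges then contradicts \<open>uniq\<close>.\<close>

lemma flow_integral:
  assumes T: "transversal \<Omega> T" and z: "z \<in> flows"
    and uniq: "\<And>w. w \<in> flows \<Longrightarrow> (\<And>h. h \<in> H \<Longrightarrow> z h \<in> \<int> \<Longrightarrow> w h = 0) \<Longrightarrow>
      (\<And>t. t \<in> T \<Longrightarrow> coord (Inl t) z \<in> \<int> \<Longrightarrow> coord (Inl t) w = 0) \<Longrightarrow> \<forall>h\<in>H. w h = 0"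
  shows "\<forall>h\<in>H. z h \<in> \<int>"
proof (rule ccontr)
  assume "\<not> ?thesis"
  then have ex: "\<exists>h\<in>H. z h \<notin> \<int>" by blast
  \<comment> \<open>An integral transition coordinate must be preserved, so the two single
    transitions are balanced separately; otherwise only the whole vertex is. In both cases the sum
    of \<open>z\<close> over each block is an integer.\<close>
  define blk where "blk t = (if coord (Inl t) z \<in> \<int> then t else {\<Union>t})" for t
  define Q where "Q = (\<Union>t\<in>T. blk t)"
  have UT: "partition_on H (\<Union>T)" by (rule single_transitions_part(1)[OF T])
  have Ublk: "\<Union>(blk t) = \<Union>t" for t by (simp add: blk_def)
  have cover: "\<Union>Q = H"
  proof -
    have "\<Union>Q = (\<Union>t\<in>T. \<Union>(blk t))" unfolding Q_def by blast
    also have "\<dots> = \<Union>(\<Union>T)" unfolding Ublk by blast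
    finally show ?thesis using partition_onD1[OF UT] by simp
  qed
  have disjT: "t1 = t2" if tx: "t1 \<in> T" "t2 \<in> T" "x \<in> \<Union>t1" "x \<in> \<Union>t2" for t1 t2 x
  proof -
    obtain v where v: "transition_at F v t1" "T \<inter> cls v = {t1}" by (rule transversal_memE[OF T tx(1)])
    obtain w where w: "transition_at F w t2" "T \<inter> cls w = {t2}" by (rule transversal_memE[OF T tx(2)])
    have "x \<in> halfs_at F v" "x \<in> halfs_at F w"
      using tx(3,4) Union_transition[OF v(1)] Union_transition[OF w(1)] by auto
    then have "v = w" by (auto simp: halfs_at_def)
    then show ?thesis using v w by simp
  qed
  have disjQ: "disjoint Q"
    unfolding disjoint_def
  proof (intro ballI impI)
    fix p q assume pq: "p \<in> Q" "q \<in> Q" "p \<noteq> q"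
    obtain t where t: "t \<in> T" "p \<in> blk t" using pq(1) by (auto simp: Q_def)
    obtain u where u: "u \<in> T" "q \<in> blk u" using pq(2) by (auto simp: Q_def)
    show "p \<inter> q = {}"
    proof (rule ccontr)
      assume "p \<inter> q \<noteq> {}"
      then obtain x where x: "x \<in> p" "x \<in> q" by blast
      have "x \<in> \<Union>t" "x \<in> \<Union>u" using x t(2) u(2) Ublk[of t] Ublk[of u] by blast+
      then have tu: "t = u" using disjT t(1) u(1) by blast
      show False
      proof (cases "coord (Inl t) z \<in> \<int>")
        case True
        then have "p \<in> \<Union>T" "q \<in> \<Union>T" using t u tu by (auto simp: blk_def)
        then show False using disjointD[OF partition_onD2[OF UT] _ _ pq(3)] x by blast
      next
        case False
        then show False using t u tu pq(3) by (auto simp: blk_def)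
      qed
    qed
  qed
  have ne: "{} \<notin> Q"
  proof
    assume "{} \<in> Q"
    then obtain t where t: "t \<in> T" "{} \<in> blk t" by (auto simp: Q_def)
    obtain v where v: "v \<in> V" "transition_at F v t" by (rule transversal_memE[OF T t(1)])
    have "{} \<notin> t" using single_transition_card(1)[OF v(2), of "{}"] by auto
    moreover have "\<Union>t \<noteq> {}" using Union_transition[OF v(2)] halfs_at_nonempty[OF v(1)] by simp
    ultimately show False using t(2) by (auto simp: blk_def split: if_splits)
  qed
  have partQ: "partition_on H Q" using cover disjQ ne by (simp add: partition_on_def)
  have zv: "sum z (halfs_at F v) = 0" if "v \<in> V" for v using z that by (simp add: flows_def)
  have int: "sum z p \<in> \<int>" if p: "p \<in> edges F \<union> Q" for p
  proof (cases "p \<in> edges F")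
    case True
    then show ?thesis using z by (simp add: flows_def)
  next
    case False
    then obtain t where t: "t \<in> T" "p \<in> blk t" using p by (auto simp: Q_def)
    obtain v where v: "v \<in> V" "transition_at F v t" by (rule transversal_memE[OF T t(1)])
    show ?thesis
    proof (cases "coord (Inl t) z \<in> \<int>")
      case True
      then have "p \<in> t" using t(2) by (simp add: blk_def)
      then show ?thesis using coord_transition[OF v(2) zv[OF v(1)]] True by force
    next
      case False
      then have "p = halfs_at F v" using t(2) Union_transition[OF v(2)] by (simp add: blk_def)
      then show ?thesis using zv[OF v(1)] by simp
    qed
  qed
  from nonintegral_perturbation[OF finite_H edges_part partQ int ex] obtain w :: "'h \<Rightarrow> real" where
    w: "\<exists>h\<in>H. w h \<noteq> 0" "\<forall>h. z h \<in> \<int> \<longrightarrow> w h = 0" "\<forall>p\<in>edges F \<union> Q. sum w p = 0" by blast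
  have wT: "sum w s = 0" if "t \<in> T" "s \<in> t" "coord (Inl t) z \<in> \<int>" for t s
    using w(3) that by (auto simp: Q_def blk_def)
  have wV: "sum w (halfs_at F v) = 0" if v: "v \<in> V" for v
  proof -
    obtain t where t: "t \<in> T" "transition_at F v t" by (rule transversalE[OF T v])
    show ?thesis
    proof (cases "coord (Inl t) z \<in> \<int>")
      case True
      obtain a where a: "a \<in> halfs_at F v" using halfs_at_nonempty[OF v] by blast
      obtain b c d where e: "halfs_at F v = {a, b, c, d}" "distinct [a, b, c, d]" "t = {{a, b}, {c, d}}"
        by (rule transition_atE[OF t(2) a])
      have "sum w {a, b} = 0" "sum w {c, d} = 0" using wT[OF t(1) _ True] unfolding e(3) by simp_all
      then show ?thesis using e(1,2) by simp
    next
      case False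
      then have "halfs_at F v \<in> Q"
        using t(1) Union_transition[OF t(2)] unfolding Q_def by (intro UN_I[of t]) (simp_all add: blk_def)
      then show ?thesis using w(3) by blast
    qed
  qed
  \<comment> \<open>At the roots \<open>z\<close> is zero, hence integral, so \<open>w\<close>
    vanishes there as well.\<close>
  have "w \<in> flows" using w wV z by (auto simp: flows_def)
  moreover have "coord (Inl t) w = 0" if t: "t \<in> T" "coord (Inl t) z \<in> \<int>" for t
  proof -
    obtain v where "transition_at F v t" by (rule transversal_memE[OF T t(1)])
    then obtain s where "s \<in> t" unfolding transition_at_def by blast
    then have "(SOME s. s \<in> t) \<in> t" by (rule someI)
    then show ?thesis using wT[OF t(1) _ t(2)] by simp
  qed
  ultimately have "\<forall>h\<in>H. w h = 0" using uniq w(2) by blast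
  then show False using w(1) by blast
qed

lemma coord_cong:
  assumes "t \<in> transitions F" "\<And>h. h \<in> H \<Longrightarrow> z h = w h"
  shows "coord (Inl t) z = coord (Inl t) w"
proof -
  obtain v where v: "transition_at F v t" using assms(1) by (auto simp: transitions_def)
  then obtain s where "s \<in> t" unfolding transition_at_def by blast
  then have "(SOME s. s \<in> t) \<in> t" by (rule someI)
  from single_transition_card(2)[OF v this] have "(SOME s. s \<in> t) \<subseteq> H" by (auto simp: halfs_at_def)
  then show ?thesis using assms(2) unfolding coord_simps by (intro sum.cong) auto
qed

lemma rk_le_card_basis:
  assumes "X \<subseteq> H" "fl.spans (Inr ` X) (Inr ` H)" "S \<subseteq> transitions F"
  shows "fl.rk (Inl ` S) \<le> card X"
proof -
  have fS: "finite (Inl ` S :: ('h set set + 'h) set)"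
    using finite_subset[OF assms(3) finite_transitions] by simp
  have fX: "finite X" using assms(1) finite_H finite_subset by blast
  obtain B where B: "B \<subseteq> Inl ` S" "fl.indep B" "fl.spans B (Inl ` S)"
    by (rule fl.indep_extend[OF fS empty_subsetI fl.indep_empty])
  have fB: "finite B" using B(1) fS finite_subset by blast
  have "fl.spans (Inr ` X) B"
    unfolding fl.spans_def
  proof (intro ballI impI)
    fix z s assume z: "z \<in> flows" "\<forall>a\<in>Inr ` X. coord a z = 0" and s: "s \<in> B"
    obtain t where t: "s = Inl t" "t \<in> transitions F" using B(1) s assms(3) by blast
    have "z h = 0" if "h \<in> H" for h
      using assms(2) z that unfolding fl.spans_def by fastforce
    then have "coord (Inl t) z = coord (Inl t) (\<lambda>_. 0)" by (rule coord_cong[OF t(2)])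
    then show "coord s z = 0" using t(1) by simp
  qed
  then have "card B \<le> card (Inr ` X :: ('h set set + 'h) set)"
    using fl.card_indep_le[OF B(2) fB] fX by blast
  then show ?thesis using fl.rk_eqI[OF fS B] by (simp add: card_image)
qed

end

section \<open>The representing matrix in a basis dual to half-edges\<close>

locale rooted_graph_basis = rooted_four_regular_graph F E0
  for F :: "('v, 'h) hgraph" and E0 :: "'h set" +
  fixes X :: "'h set" and y :: "'h \<Rightarrow> 'h \<Rightarrow> real" and \<xi> :: "nat \<Rightarrow> 'h"
  assumes X_H: "X \<subseteq> H" and X_indep: "fl.indep (Inr ` X)" and X_spans: "fl.spans (Inr ` X) (Inr ` H)"
    and y_flow: "\<And>f. f \<in> X \<Longrightarrow> y f \<in> flows"
    and y_dual: "\<And>f g. f \<in> X \<Longrightarrow> g \<in> X \<Longrightarrow> y f g = of_bool (f = g)"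
    and \<xi>_bij: "bij_betw \<xi> {..<card V} X"
begin

abbreviation "m \<equiv> card V"

definition M :: "nat \<Rightarrow> 'h set set \<Rightarrow> real" where
  "M i t = coord (Inl t) (y (\<xi> i))"

lemma finite_X: "finite X"
  using X_H finite_H finite_subset by blast

lemma card_X: "card X = m"
  using bij_betw_same_card[OF \<xi>_bij] by simp

lemma \<xi>_X: "i < m \<Longrightarrow> \<xi> i \<in> X"
  using \<xi>_bij by (auto simp: bij_betw_def)

lemma \<xi>_inj: "i < m \<Longrightarrow> j < m \<Longrightarrow> \<xi> i = \<xi> j \<longleftrightarrow> i = j"
  using \<xi>_bij by (auto simp: bij_betw_def inj_on_def)

lemma flow_zero: "w \<in> flows \<Longrightarrow> (\<And>f. f \<in> X \<Longrightarrow> w f = 0) \<Longrightarrow> h \<in> H \<Longrightarrow> w h = 0"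
  using X_spans unfolding fl.spans_def by fastforce

lemma flow_expand:
  assumes "w \<in> flows" "h \<in> H"
  shows "w h = (\<Sum>f\<in>X. w f * y f h)"
proof -
  have "(\<lambda>h. w h - (\<Sum>f\<in>X. w f * y f h)) \<in> flows"
    by (rule fl.residual_mem[OF assms(1) y_flow])
  moreover have "w g - (\<Sum>f\<in>X. w f * y f g) = 0" if g: "g \<in> X" for g
  proof -
    have "(\<Sum>f\<in>X. w f * y f g) = (\<Sum>f\<in>X. w f * of_bool (f = g))"
      using y_dual g by (intro sum.cong) auto
    then show ?thesis using g finite_X by (simp add: sum_of_bool_mult)
  qed
  ultimately have "w h - (\<Sum>f\<in>X. w f * y f h) = 0"
    using flow_zero[of "\<lambda>h. w h - (\<Sum>f\<in>X. w f * y f h)"] assms(2) by blast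
  then show ?thesis by simp
qed

lemma coord_expand:
  assumes "w \<in> flows" "t \<in> transitions F"
  shows "coord (Inl t) w = (\<Sum>i<m. w (\<xi> i) * M i t)"
proof -
  have "coord (Inl t) w = coord (Inl t) (\<lambda>h. \<Sum>f\<in>X. w f * y f h)"
    using assms(2) flow_expand[OF assms(1)] by (rule coord_cong)
  also have "\<dots> = (\<Sum>f\<in>X. w f * coord (Inl t) (y f))"
    by (rule functional_lincomb[OF fl.functional])
  also have "\<dots> = (\<Sum>i<m. w (\<xi> i) * M i t)"
    unfolding M_def by (rule sum.reindex_bij_betw[OF \<xi>_bij, symmetric])
  finally show ?thesis .
qed

text \<open>Every flow agrees on \<open>H\<close> with its expansion in \<open>y\<close>, and
  transition functionals only see \<open>H\<close>; so a linear relation holds on all flows as soon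
  as it holds in every row.\<close>

lemma lin_indep_cols_iff:
  assumes "finite A" "A \<subseteq> transitions F"
  shows "lin_indep_cols m M A \<longleftrightarrow> fl.indep (Inl ` A)"
proof -
  have fin: "finite (Inl ` A :: ('h set set + 'h) set)" using assms(1) by simp
  have sum: "(\<Sum>i\<in>Inl ` A. c i * coord i z) = (\<Sum>t\<in>A. c (Inl t) * coord (Inl t) z)"
    for c :: "'h set set + 'h \<Rightarrow> real" and z
    by (subst sum.reindex) simp_all
  have eq: "(\<forall>z\<in>flows. (\<Sum>t\<in>A. c t * coord (Inl t) z) = 0) \<longleftrightarrow> (\<forall>i<m. (\<Sum>t\<in>A. c t * M i t) = 0)" for c
  proof
    assume "\<forall>z\<in>flows. (\<Sum>t\<in>A. c t * coord (Inl t) z) = 0"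
    then show "\<forall>i<m. (\<Sum>t\<in>A. c t * M i t) = 0"
      using y_flow[OF \<xi>_X] unfolding M_def by blast
  next
    assume r: "\<forall>i<m. (\<Sum>t\<in>A. c t * M i t) = 0"
    show "\<forall>z\<in>flows. (\<Sum>t\<in>A. c t * coord (Inl t) z) = 0"
    proof
      fix z assume z: "z \<in> flows"
      have "(\<Sum>t\<in>A. c t * coord (Inl t) z) = (\<Sum>t\<in>A. \<Sum>i<m. z (\<xi> i) * (c t * M i t))"
      proof (rule sum.cong)
        fix t assume "t \<in> A"
        then have "coord (Inl t) z = (\<Sum>i<m. z (\<xi> i) * M i t)" using coord_expand[OF z] assms(2) by blast
        then show "c t * coord (Inl t) z = (\<Sum>i<m. z (\<xi> i) * (c t * M i t))"
          by (simp add: sum_distrib_left mult.left_commute del: coord_simps)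
      qed simp
      also have "\<dots> = (\<Sum>i<m. z (\<xi> i) * (\<Sum>t\<in>A. c t * M i t))"
        by (subst sum.swap) (simp add: sum_distrib_left)
      also have "\<dots> = 0" using r by simp
      finally show "(\<Sum>t\<in>A. c t * coord (Inl t) z) = 0" .
    qed
  qed
  show ?thesis
    unfolding fl.indep_iff[OF fin] lin_indep_cols_def sum
  proof
    assume l: "\<forall>c. (\<forall>i<m. (\<Sum>x\<in>A. c x * M i x) = 0) \<longrightarrow> (\<forall>x\<in>A. c x = 0)"
    show "\<forall>c :: 'h set set + 'h \<Rightarrow> real. (\<forall>z\<in>flows. (\<Sum>t\<in>A. c (Inl t) * coord (Inl t) z) = 0) \<longrightarrow> (\<forall>a\<in>Inl ` A. c a = 0)"
    proof (intro allI impI)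
      fix c :: "'h set set + 'h \<Rightarrow> real"
      assume "\<forall>z\<in>flows. (\<Sum>t\<in>A. c (Inl t) * coord (Inl t) z) = 0"
      then have "\<forall>i<m. (\<Sum>x\<in>A. c (Inl x) * M i x) = 0" by (rule eq[THEN iffD1])
      then have "\<forall>x\<in>A. c (Inl x) = 0" using spec[OF l, of "\<lambda>x. c (Inl x)"] by blast
      then show "\<forall>a\<in>Inl ` A. c a = 0" by blast
    qed
  next
    assume l: "\<forall>c :: 'h set set + 'h \<Rightarrow> real. (\<forall>z\<in>flows. (\<Sum>t\<in>A. c (Inl t) * coord (Inl t) z) = 0) \<longrightarrow> (\<forall>a\<in>Inl ` A. c a = 0)"
    show "\<forall>c. (\<forall>i<m. (\<Sum>x\<in>A. c x * M i x) = 0) \<longrightarrow> (\<forall>x\<in>A. c x = 0)"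
    proof (intro allI impI)
      fix c :: "'h set set \<Rightarrow> real" assume "\<forall>i<m. (\<Sum>x\<in>A. c x * M i x) = 0"
      then have "\<forall>z\<in>flows. (\<Sum>t\<in>A. c t * coord (Inl t) z) = 0" by (rule eq[THEN iffD2])
      then have "\<forall>a\<in>Inl ` A. (case a of Inl t \<Rightarrow> c t | Inr _ \<Rightarrow> 0) = 0"
        using spec[OF l, of "\<lambda>a. case a of Inl t \<Rightarrow> c t | Inr _ \<Rightarrow> 0"] by simp
      then show "\<forall>x\<in>A. c x = 0" by simp
    qed
  qed
qed

lemma col_rank_eq:
  assumes "S \<subseteq> transitions F"
  shows "col_rank m M S = fl.rk (Inl ` S)"
proof -
  have fS: "finite S" using assms finite_transitions finite_subset by blast
  have "{card A |A. A \<subseteq> S \<and> lin_indep_cols m M A} = {card A |A. A \<subseteq> Inl ` S \<and> fl.indep A}"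
  proof (intro equalityI subsetI)
    fix n assume "n \<in> {card A |A. A \<subseteq> S \<and> lin_indep_cols m M A}"
    then obtain A where A: "n = card A" "A \<subseteq> S" "lin_indep_cols m M A" by blast
    have "fl.indep (Inl ` A)"
      using A lin_indep_cols_iff[of A] finite_subset[OF A(2) fS] assms by blast
    moreover have "card (Inl ` A :: ('h set set + 'h) set) = n" using A(1) by (simp add: card_image)
    ultimately show "n \<in> {card A |A. A \<subseteq> Inl ` S \<and> fl.indep A}" using A(2) by blast
  next
    fix n assume "n \<in> {card A |A. A \<subseteq> Inl ` S \<and> fl.indep A}"
    then obtain B where B: "n = card B" "B \<subseteq> Inl ` S" "fl.indep B" by blast
    then obtain A where A: "A \<subseteq> S" "B = Inl ` A" by (auto simp: subset_image_iff)
    have "lin_indep_cols m M A"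
      using A B(3) lin_indep_cols_iff[of A] finite_subset[OF A(1) fS] assms by blast
    moreover have "n = card A" using B(1) A(2) by (simp add: card_image)
    ultimately show "n \<in> {card A |A. A \<subseteq> S \<and> lin_indep_cols m M A}" using A(1) by blast
  qed
  then show ?thesis by (simp add: col_rank_def fl.rk_def)
qed

lemma euler_rank_eq: "euler_rank F = rank"
proof (rule euler_rank_eqI[OF multimatroid_rank])
  fix T assume T: "transversal \<Omega> T"
  have "fl.rk (Inl ` T) + num_circuits F T = m + num_components F"
    using rank_formula[OF T X_H X_indep X_spans] card_X by simp
  moreover have "rank T = fl.rk (Inl ` T)" using subtransversalI[OF T] by (simp add: rank_def)
  ultimately show "int (rank T) = int m - (int (num_circuits F T) - int (num_components F))" by linarith
qed (simp add: rank_def)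

lemma col_rank_rank: "subtransversal \<Omega> S \<Longrightarrow> col_rank m M S = rank S"
  using col_rank_eq[OF subtransversal_transitions] by (simp add: rank_def)

lemma rank_le: "subtransversal \<Omega> S \<Longrightarrow> rank S \<le> m"
  using matroid_rank_onD(1)[OF matroid_rank, of S S] subtransversal_card(2)[of S] by simp

text \<open>Both ranks equal |V|: a subtransversal of full rank attains it, while the size of
  subtransversals and the size of the basis \<open>X\<close> bound it from above.\<close>

lemma strict: "strict_representation (transitions F) \<Omega> (euler_rank F) m M"
  unfolding strict_representation_def representation_def euler_rank_eq
proof (intro conjI allI impI)
  show "col_rank m M S = rank S" if "subtransversal \<Omega> S" for S by (rule col_rank_rank[OF that])
  obtain S where S: "subtransversal \<Omega> S" "rank S = m"
    using multimatroid_full_rank[OF multimatroid_rank, of m] by auto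
  have "Max (rank ` {S. subtransversal \<Omega> S}) = m"
  proof (rule Max_eqI)
    have "rank ` {S. subtransversal \<Omega> S} \<subseteq> {..m}" using rank_le by auto
    then show "finite (rank ` {S. subtransversal \<Omega> S})" using finite_subset by blast
    show "n \<le> m" if "n \<in> rank ` {S. subtransversal \<Omega> S}" for n using that rank_le by auto
    show "m \<in> rank ` {S. subtransversal \<Omega> S}" using S by (auto simp: image_iff)
  qed
  moreover have "fl.rk (Inl ` transitions F) = m"
  proof (rule antisym)
    have fU: "finite (Inl ` transitions F :: ('h set set + 'h) set)" using finite_transitions by simp
    show "fl.rk (Inl ` transitions F) \<le> m"
      using rk_le_card_basis[OF X_H X_spans subset_refl] card_X by simp
    have "fl.rk (Inl ` S) \<le> fl.rk (Inl ` transitions F)"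
      using matroid_rank_onD(2)[OF fl.matroid_rank_rk[OF fU]] subtransversal_transitions[OF S(1)]
      by (meson image_mono order_refl)
    then show "m \<le> fl.rk (Inl ` transitions F)" using S by (simp add: rank_def)
  qed
  ultimately show "col_rank m M (transitions F) = Max (rank ` {S. subtransversal \<Omega> S})"
    using col_rank_eq[OF subset_refl] by simp
qed

text \<open>The values on \<open>X\<close> are \<open>0\<close> and \<open>1\<close>, and values on
  \<open>X\<close> determine a flow on \<open>H\<close>, so \<open>flow_integral\<close> applies
  with an arbitrary transversal.\<close>

lemma y_integral:
  assumes "f \<in> X" "h \<in> H"
  shows "y f h \<in> \<int>"
proof -
  obtain T where T: "transversal \<Omega> T" using transversal_exists by blast
  have "\<forall>h\<in>H. y f h \<in> \<int>"
  proof (rule flow_integral[OF T y_flow[OF assms(1)]])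
    fix w assume w: "w \<in> flows" "\<And>h. h \<in> H \<Longrightarrow> y f h \<in> \<int> \<Longrightarrow> w h = 0"
    have "w g = 0" if g: "g \<in> X" for g
      using w(2)[of g] y_dual[OF assms(1) g] g X_H by auto
    then show "\<forall>h\<in>H. w h = 0" using flow_zero[OF w(1)] by blast
  qed
  then show ?thesis using assms(2) by blast
qed

lemma coord_integral:
  assumes "t \<in> transitions F" "\<And>h. h \<in> H \<Longrightarrow> z h \<in> \<int>"
  shows "coord (Inl t) z \<in> \<int>"
proof -
  obtain v where v: "transition_at F v t" using assms(1) by (auto simp: transitions_def)
  then obtain s where "s \<in> t" unfolding transition_at_def by blast
  then have "(SOME s. s \<in> t) \<in> t" by (rule someI)
  from single_transition_card(2)[OF v this] have "(SOME s. s \<in> t) \<subseteq> H" by (auto simp: halfs_at_def)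
  then show ?thesis using assms(2) unfolding coord_simps by (intro Ints_sum) auto
qed

lemma unimodular:
  assumes T: "transversal \<Omega> T"
  shows "totally_unimodular_cols m M T"
  unfolding totally_unimodular_cols_def
proof (intro allI impI)
  fix k :: nat and f :: "nat \<Rightarrow> nat" and g :: "nat \<Rightarrow> 'h set set"
  assume fg: "inj_on f {..<k} \<and> f ` {..<k} \<subseteq> {..<m} \<and> inj_on g {..<k} \<and> g ` {..<k} \<subseteq> T"
  have TU: "T \<subseteq> transitions F" by (rule subtransversal_transitions[OF subtransversalI[OF T subset_refl]])
  have f: "f i < m" if "i < k" for i using fg that by auto
  have g: "g j \<in> T" "g j \<in> transitions F" if "j < k" for j using fg that TU by auto
  define N where "N = mat k k (\<lambda>(i, j). M (f i) (g j))"
  have N: "N \<in> carrier_mat k k" by (simp add: N_def)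
  have Nij: "N $$ (i, j) = M (f i) (g j)" if "i < k" "j < k" for i j using that by (simp add: N_def)
  show "det (mat k k (\<lambda>(i, j). M (f i) (g j))) \<in> {-1, 0, 1}"
  proof (cases "det N = 0")
    case True
    then show ?thesis by (simp add: N_def)
  next
    case False
    from det_non_zero_imp_unit[OF N False, of "()"] obtain B where
      B: "B \<in> carrier_mat k k" "B * N = 1\<^sub>m k" "N * B = 1\<^sub>m k"
      by (auto simp: Units_def ring_mat_def)
    have BN: "(\<Sum>i<k. B $$ (l, i) * M (f i) (g j)) = of_bool (l = j)" if "l < k" "j < k" for l j
    proof -
      have "(B * N) $$ (l, j) = (\<Sum>i<k. B $$ (l, i) * N $$ (i, j))"
        using B(1) N that by (simp add: scalar_prod_def atLeast0LessThan)
      then show ?thesis using that Nij unfolding B(2) by (cases "l = j") auto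
    qed
    have NB: "(\<Sum>j<k. M (f i) (g j) * B $$ (j, l)) = of_bool (i = l)" if "i < k" "l < k" for i l
    proof -
      have "(N * B) $$ (i, l) = (\<Sum>j<k. N $$ (i, j) * B $$ (j, l))"
        using B(1) N that by (simp add: scalar_prod_def atLeast0LessThan)
      then show ?thesis using that Nij unfolding B(3) by (cases "i = l") auto
    qed
    have Bint: "B $$ (l, i) \<in> \<int>" if l: "l < k" and i: "i < k" for l i
    proof -
      \<comment> \<open>Row \<open>l\<close> of the inverse, read as a flow: its values on
        \<open>X\<close> are the entries of that row and zeros, and its transition coordinates at
        the selected columns form a unit vector. Integrality of \<open>z\<close> thus gives
        integrality of the row.\<close>
      define z where "z = (\<lambda>h. \<Sum>i<k. B $$ (l, i) * y (\<xi> (f i)) h)"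
      have z: "z \<in> flows" unfolding z_def by (rule fl.lincomb_mem) (use y_flow \<xi>_X f in auto)
      have zf: "z (\<xi> (f i)) = B $$ (l, i)" if i: "i < k" for i
      proof -
        have "z (\<xi> (f i)) = (\<Sum>i'<k. B $$ (l, i') * of_bool (i' = i))"
          unfolding z_def
        proof (rule sum.cong)
          fix i' assume i': "i' \<in> {..<k}"
          have "f i' = f i \<longleftrightarrow> i' = i" using fg i' i by (auto simp: inj_on_def)
          then have "y (\<xi> (f i')) (\<xi> (f i)) = of_bool (i' = i)"
            using y_dual \<xi>_X \<xi>_inj f i i' by simp
          then show "B $$ (l, i') * y (\<xi> (f i')) (\<xi> (f i)) = B $$ (l, i') * of_bool (i' = i)" by simp
        qed simp
        then show ?thesis using i by (simp add: sum_of_bool_mult)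
      qed
      have zx: "z (\<xi> r) = 0" if r: "r < m" "r \<notin> f ` {..<k}" for r
      proof -
        have "y (\<xi> (f i)) (\<xi> r) = 0" if "i < k" for i
        proof -
          have "f i \<noteq> r" using r(2) that by blast
          then show ?thesis using y_dual[OF \<xi>_X \<xi>_X] \<xi>_inj f[OF that] r(1) by simp
        qed
        then show ?thesis unfolding z_def by simp
      qed
      have zg: "coord (Inl (g j)) z = of_bool (l = j)" if j: "j < k" for j
      proof -
        have "coord (Inl (g j)) z = (\<Sum>i<k. B $$ (l, i) * coord (Inl (g j)) (y (\<xi> (f i))))"
          unfolding z_def by (rule functional_lincomb[OF fl.functional])
        then show ?thesis using BN[OF l j] by (simp add: M_def)
      qed
      have "\<forall>h\<in>H. z h \<in> \<int>"
      proof (rule flow_integral[OF T z])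
        \<comment> \<open>Within \<open>X\<close>, such a \<open>w\<close> can be nonzero only at
          the selected rows, and its coordinates at the selected columns vanish; invertibility of
          \<open>N\<close> then makes it zero.\<close>
        fix w assume w: "w \<in> flows" "\<And>h. h \<in> H \<Longrightarrow> z h \<in> \<int> \<Longrightarrow> w h = 0"
          "\<And>t. t \<in> T \<Longrightarrow> coord (Inl t) z \<in> \<int> \<Longrightarrow> coord (Inl t) w = 0"
        have w0: "w (\<xi> r) = 0" if r: "r < m" "r \<notin> f ` {..<k}" for r
          using w(2)[of "\<xi> r"] zx[OF r] \<xi>_X[OF r(1)] X_H by auto
        have wg: "(\<Sum>i<k. w (\<xi> (f i)) * M (f i) (g j)) = 0" if j: "j < k" for j
        proof -
          have "coord (Inl (g j)) w = 0" using w(3)[OF g(1)[OF j]] zg[OF j] by simp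
          moreover have "coord (Inl (g j)) w = (\<Sum>r<m. w (\<xi> r) * M r (g j))"
            by (rule coord_expand[OF w(1) g(2)[OF j]])
          moreover have "\<dots> = (\<Sum>r\<in>f ` {..<k}. w (\<xi> r) * M r (g j))"
            using fg w0 by (intro sum.mono_neutral_right) auto
          moreover have "\<dots> = (\<Sum>i<k. w (\<xi> (f i)) * M (f i) (g j))"
            using fg by (simp add: sum.reindex)
          ultimately show ?thesis by simp
        qed
        have wf: "w (\<xi> (f i)) = 0" if i: "i < k" for i
        proof -
          have "0 = (\<Sum>j<k. (\<Sum>i'<k. w (\<xi> (f i')) * M (f i') (g j)) * B $$ (j, i))"
            using wg by simp
          also have "\<dots> = (\<Sum>j<k. \<Sum>i'<k. w (\<xi> (f i')) * (M (f i') (g j) * B $$ (j, i)))"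
            by (simp add: sum_distrib_right mult.assoc)
          also have "\<dots> = (\<Sum>i'<k. w (\<xi> (f i')) * (\<Sum>j<k. M (f i') (g j) * B $$ (j, i)))"
            by (subst sum.swap) (simp add: sum_distrib_left)
          also have "\<dots> = (\<Sum>i'<k. w (\<xi> (f i')) * of_bool (i' = i))"
            using NB i by (intro sum.cong) auto
          also have "\<dots> = w (\<xi> (f i))" using i by (simp add: sum_of_bool_mult)
          finally show ?thesis by simp
        qed
        have "w x = 0" if xX: "x \<in> X" for x
        proof -
          obtain r where r: "r < m" "x = \<xi> r" using xX \<xi>_bij by (auto simp: bij_betw_def)
          show ?thesis using w0[OF r(1)] wf r(2) by (cases "r \<in> f ` {..<k}") auto
        qed
        then show "\<forall>h\<in>H. w h = 0" using flow_zero[OF w(1)] by blast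
      qed
      then show ?thesis using zf[OF i] \<xi>_X[OF f[OF i]] X_H by (metis subsetD)
    qed
    have Nint: "N $$ (i, j) \<in> \<int>" if "i < k" "j < k" for i j
      unfolding Nij[OF that] M_def using y_integral[OF \<xi>_X[OF f[OF that(1)]]] g(2)[OF that(2)]
      by (intro coord_integral) auto
    have "det N \<in> {-1, 0, 1}" by (rule det_unimodular[OF N B(1,2) Nint Bint])
    then show ?thesis by (simp add: N_def)
  qed
qed

end

theorem mainTheorem14:
  fixes F :: "('v, 'h) hgraph"
  assumes "wf_hgraph F" and "four_regular F"
  shows "\<exists>m M. strict_representation (transitions F) (skew_classes F) (euler_rank F) m M \<and>
                totally_transversally_unimodular (skew_classes F) m M"
proof -
  interpret four_regular_graph F by unfold_locales (fact assms)+
  obtain E0 where E0: "E0 \<subseteq> H" "inj_on (inc F) E0" "card E0 = num_components F"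
    "\<And>a b. a \<in> E0 \<Longrightarrow> b \<in> E0 \<Longrightarrow> (inc F a, inc F b) \<in> (adj_rel F)\<^sup>* \<Longrightarrow> a = b"
    "\<And>v. v \<in> V \<Longrightarrow> \<exists>e\<in>E0. (inc F e, v) \<in> (adj_rel F)\<^sup>*"
    using component_roots by blast
  interpret rooted_four_regular_graph F E0 by unfold_locales (use E0 in blast)+
  obtain X y where X: "X \<subseteq> H" "fl.indep (Inr ` X)" "fl.spans (Inr ` X) (Inr ` H)"
    "\<And>f. f \<in> X \<Longrightarrow> y f \<in> flows" "\<And>f g. f \<in> X \<Longrightarrow> g \<in> X \<Longrightarrow> y f g = of_bool (f = g)"
    using basis_exists by blast
  \<comment> \<open>Counting gives one inequality. For the other, a subtransversal of rank |V|
    exists by the multimatroid axiom, and its rank cannot exceed the dimension.\<close>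
  have "card X = card V"
  proof (rule antisym)
    show "card X \<le> card V" by (rule basis_card_le[OF X(1,2)])
    obtain S where S: "subtransversal \<Omega> S" "rank S = card V"
      using multimatroid_full_rank[OF multimatroid_rank, of "card V"] by auto
    then show "card V \<le> card X"
      using rk_le_card_basis[OF X(1,3) subtransversal_transitions[OF S(1)]] by (simp add: rank_def)
  qed
  then obtain \<xi> where "bij_betw \<xi> {..<card V} X"
    using ex_bij_betw_nat_finite[of X] X(1) finite_H by (auto simp: atLeast0LessThan intro: finite_subset)
  then interpret rooted_graph_basis F E0 X y \<xi> by unfold_locales (use X in auto)
  show ?thesis
    using strict unimodular unfolding totally_transversally_unimodular_def by blast
qed

end
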